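(* \begin{align*} \mu_2(1+x+y) &= \frac{24}{5\pi}\,\mathrm{Ti}_3\!\left(\frac{1}{\sqrt3}\right) + \frac{2\log 3}{\pi}\,\mathrm{Cl}_2\!\left(\frac{\pi}{3}\right) - \frac{\log^2 3}{10} - \frac{19\pi^2}{180}\\ &= \frac{\pi^2}{4} + \frac{3}{\pi}\,\mathrm{Ls}_3\!\left(\frac{2\pi}{3}\right). \end{align*}
   Context: For a Laurent polynomial $P$ in $n$ variables and a positive integer $k$, the higher Mahler measure is $\mu_k(P) := \int_0^1\cdots\int_0^1 \log^k\left|P\left(e^{2\pi i t_1},\ldots,e^{2\pi i t_n}\right)\right|\mathrm{d}t_1\cdots\mathrm{d}t_n$; here $P=1+x+y$ in two variables. $\mathrm{Ti}_3(x) := \sum_{n=0}^\infty (-1)^n\frac{x^{2n+1}}{(2n+1)^3}$, $\mathrm{Cl}_2(\theta) := \sum_{n=1}^\infty\frac{\sin(n\theta)}{n^2}$, and $\mathrm{Ls}_3(\sigma) := -\int_0^\sigma \log^2\left|2\sin\frac{\theta}{2}\right|\mathrm{d}\theta$. *)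

theory Defs
  imports "HOL-Analysis.Analysis"
begin

definition higher_mahler2 :: "nat \<Rightarrow> (complex \<Rightarrow> complex \<Rightarrow> complex) \<Rightarrow> real" where
  "higher_mahler2 k P =
     (LINT t|lebesgue_on ({0..1} \<times> {0..1}).
        (ln (cmod (P (cis (2 * pi * fst t)) (cis (2 * pi * snd t))))) ^ k)"

definition Ti3 :: "real \<Rightarrow> real" where
  "Ti3 x = (\<Sum>n. (-1) ^ n * x ^ (2 * n + 1) / (real (2 * n + 1)) ^ 3)"

definition Cl2 :: "real \<Rightarrow> real" where
  "Cl2 \<theta> = (\<Sum>n. sin (real (Suc n) * \<theta>) / (real (Suc n)) ^ 2)"

definition Ls3 :: "real \<Rightarrow> real" where
  "Ls3 \<sigma> = - (LBINT \<theta>=0..\<sigma>. (ln \<bar>2 * sin (\<theta> / 2)\<bar>) ^ 2)"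

end

theory Submission
  imports Defs "HOL-Complex_Analysis.Complex_Analysis" "HOL-Real_Asymp.Real_Asymp"
begin

text \<open>
  For fixed x with \<open>\<bar>1 + x\<bar> = 2 sin \<phi>\<close>, Parseval's identity gives the mean over y of
  \<open>ln\<^sup>2 \<bar>1 + x + y\<bar>\<close> in terms of the dilogarithm. Scaling y by \<open>2 sin \<alpha>\<close>, with \<open>\<alpha>\<close> running
  from 0 to \<open>\<pi>/6\<close>, exhibits this mean as \<open>ln\<^sup>2 (2 sin \<phi>)\<close> plus an integral over \<open>\<alpha>\<close> of an
  elementary kernel. After interchanging the integrals, the integral over \<open>\<phi>\<close> of the kernel is
  \<open>2 cot \<alpha> (A(2\<alpha>) - A(\<alpha>))\<close> with \<open>A(x)\<close> the integral of \<open>ln (2 sin t)\<close> from 0 to x, and an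
  integration by parts leaves only values of \<open>S(x)\<close>, the integral of \<open>ln\<^sup>2 (2 sin t)\<close>: the
  Mahler measure is \<open>\<pi>\<^sup>2/4 - (6/\<pi>) S(\<pi>/3)\<close>.

  The inverse tangent integral at \<open>1/\<surd>3\<close> is half the integral of \<open>(ln tan t + ln 3 / 2)\<^sup>2\<close> over
  \<open>[0, \<pi>/6]\<close>. The parallelogram law for \<open>ln (2 sin t)\<close> and \<open>ln (2 cos t)\<close> reduces it to
  \<open>A(\<pi>/6) = - Cl\<^sub>2(\<pi>/3) / 2\<close>, \<open>S(\<pi>/6)\<close>, \<open>S(\<pi>/2)\<close> and \<open>S(\<pi>/3)\<close>. Here \<open>S(\<pi>/2) = \<pi>\<^sup>3/24\<close> and
  \<open>S(\<pi>/6) = 7\<pi>\<^sup>3/216\<close> follow from integrating \<open>ln\<^sup>2 (1 - z) / z\<close> along the unit circle, because the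
  endpoint z is real in the first case and has \<open>\<bar>1 - z\<bar> = 1\<close> in the second.
\<close>

section \<open>The logarithmic sine and its integrals\<close>

definition lsin :: "real \<Rightarrow> real" where
  "lsin t = ln (2 * sin t)"

lemma has_real_derivative_lsin:
  assumes "0 < sin x"
  shows "(lsin has_real_derivative cos x / sin x) (at x)"
  unfolding lsin_def using assms by (auto intro!: derivative_eq_intros simp: field_simps)

text \<open>Half angles: for \<open>x = t / 2\<close> in [0, pi/4],
  \<open>cos x \<ge> sqrt 2 / 2\<close> and hence \<open>sin x \<ge> sqrt 2 / 2 * x\<close>, and
  these multiply in \<open>sin t = 2 sin x cos x\<close>. The consequence
  \<open>t \<le> 2 * sin t\<close> lets \<open>ln t\<close> bound \<open>lsin t\<close> from below
  near the singularity.\<close>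

lemma sin_ge_half:
  fixes t :: real
  assumes "0 \<le> t" "t \<le> pi / 2"
  shows "t / 2 \<le> sin t"
proof -
  define x where "x = t / 2"
  have x: "0 \<le> x" "x \<le> pi / 4" using assms by (auto simp: x_def)
  have c: "sqrt 2 / 2 \<le> cos y" if "0 \<le> y" "y \<le> x" for y
    using cos_monotone_0_pi_le[of y "pi/4"] that x by (simp add: cos_45)
  have "sin 0 - sqrt 2 / 2 * 0 \<le> sin x - sqrt 2 / 2 * x"
  proof (rule DERIV_nonneg_imp_nondecreasing[OF x(1)])
    fix y assume y: "0 \<le> y" "y \<le> x"
    have "((\<lambda>x. sin x - sqrt 2 / 2 * x) has_real_derivative (cos y - sqrt 2 / 2)) (at y)"
      by (auto intro!: derivative_eq_intros)
    then show "\<exists>d. ((\<lambda>x. sin x - sqrt 2 / 2 * x) has_real_derivative d) (at y) \<and> 0 \<le> d"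
      using c[OF y] by (meson diff_ge_0_iff_ge)
  qed
  then have "sqrt 2 / 2 * x * (sqrt 2 / 2) \<le> sin x * cos x"
    using c[of x] x by (intro mult_mono) (auto simp: sin_ge_zero)
  moreover have "sin t = 2 * (sin x * cos x)" using sin_double[of x] by (simp add: x_def)
  moreover have "sqrt 2 / 2 * x * (sqrt 2 / 2) = x / 2"
  proof -
    have "sqrt 2 / 2 * x * (sqrt 2 / 2) = (sqrt 2 * sqrt 2) / 4 * x" by (simp add: field_simps del: real_sqrt_mult_self)
    then show ?thesis by simp
  qed
  ultimately show ?thesis unfolding x_def by linarith
qed

text \<open>Serves antiderivatives with logarithmic terms: only a one-sided limit at 0 has to be
  checked before the interior form of the fundamental theorem applies.\<close>

lemma continuous_on_Icc_zeroI:
  fixes f :: "real \<Rightarrow> 'a::topological_space"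
  assumes "(f \<longlongrightarrow> f 0) (at_right 0)" "\<And>x. 0 < x \<Longrightarrow> x \<le> b \<Longrightarrow> isCont f x"
  shows "continuous_on {0..b} f"
  unfolding continuous_on_def
proof
  fix x assume x: "x \<in> {0..b}"
  have "at 0 within {0..b} \<le> at_right (0::real)"
    unfolding at_within_def by (rule inf_mono) auto
  then show "(f \<longlongrightarrow> f x) (at x within {0..b})"
    using assms x tendsto_mono[OF _ assms(1)] unfolding isCont_def
    by (cases "x = 0") (auto intro: tendsto_within_subset[OF _ subset_UNIV])
qed

lemma ln_squared_integrable:
  assumes "0 \<le> (b::real)"
  shows "(\<lambda>x. (ln x)\<^sup>2) integrable_on {0..b}"
proof -
  \<comment> \<open>Antiderivative of the squared logarithm from two integrations by parts; it is
    continuous at 0 because x beats powers of \<open>ln x\<close>.\<close>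
  let ?F = "\<lambda>x::real. x * (ln x)\<^sup>2 - 2 * x * ln x + 2 * x"
  have c0: "(?F \<longlongrightarrow> ?F 0) (at_right 0)" by simp real_asymp
  have "continuous_on {0..b} ?F"
    using c0 by (intro continuous_on_Icc_zeroI) (auto intro!: continuous_intros)
  moreover have "(?F has_vector_derivative (ln x)\<^sup>2) (at x)" if "x \<in> {0<..<b}" for x
    unfolding has_real_derivative_iff_has_vector_derivative[symmetric]
    using that by (auto intro!: derivative_eq_intros simp: field_simps power2_eq_square)
  ultimately show ?thesis
    by (rule has_integral_integrable[OF fundamental_theorem_of_calculus_interior[OF assms]])
qed

section \<open>Integrability of the log-sine and of its square\<close>

lemma lsin_borel [measurable]: "lsin \<in> borel_measurable borel"
  unfolding lsin_def by measurable

lemma borel_imp_lebesgue_on: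
  assumes "(f :: real \<Rightarrow> 'b::euclidean_space) \<in> borel_measurable borel"
  shows "f \<in> borel_measurable (lebesgue_on S)"
  using assms by (simp add: measurable_completion measurable_restrict_space1)

text \<open>The squeeze \<open>ln t \<le> lsin t \<le> ln 2\<close> bounds \<open>lsin t\<close> in
  absolute value by the larger of \<open>\<bar>ln t\<bar>\<close> and \<open>ln 2\<close>, and the
  sum of both squares is integrable.\<close>

lemma lsin_squared_integrable_half: "(\<lambda>t. (lsin t)\<^sup>2) integrable_on {0..pi/2}"
proof (rule measurable_bounded_by_integrable_imp_integrable)
  show "(\<lambda>t. (lsin t)\<^sup>2) \<in> borel_measurable (lebesgue_on {0..pi/2})"
    by (rule borel_imp_lebesgue_on) measurable
  show "(\<lambda>x. (ln x)\<^sup>2 + (ln 2)\<^sup>2) integrable_on {0..pi/2}"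
    by (intro integrable_add ln_squared_integrable) auto
  fix t :: real assume t: "t \<in> {0..pi/2}"
  show "norm ((lsin t)\<^sup>2) \<le> (ln t)\<^sup>2 + (ln 2)\<^sup>2"
  proof (cases "t = 0")
    case False
    then have tp: "0 < t" using t by auto
    have *: "t \<le> 2 * sin t" "2 * sin t \<le> 2" using sin_ge_half[of t] t by auto
    then have "ln t \<le> lsin t" "lsin t \<le> ln 2" using tp unfolding lsin_def
      by (intro ln_mono; simp)+
    then have "\<bar>lsin t\<bar> \<le> \<bar>ln t\<bar> \<or> \<bar>lsin t\<bar> \<le> \<bar>ln 2\<bar>" by linarith
    then have "(lsin t)\<^sup>2 \<le> (ln t)\<^sup>2 \<or> (lsin t)\<^sup>2 \<le> (ln 2)\<^sup>2"
      by (metis abs_le_square_iff)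
    then show ?thesis by (auto intro: add_increasing add_increasing2)
  qed (auto simp: lsin_def)
qed auto

lemma lsin_reflect: "lsin (pi - t) = lsin t"
  by (simp add: lsin_def)

lemma has_integral_reflect_at:
  fixes f :: "real \<Rightarrow> real"
  assumes "(f has_integral I) {a..b}"
  shows "((\<lambda>x. f (c - x)) has_integral I) {c-b..c-a}"
proof (cases "a \<le> b")
  case True
  then show ?thesis
  using has_integral_affinity[of f I a b "-1" c] assms True
  by (simp add: image_affinity_atLeastAtMost)
next
  case False then show ?thesis using assms by auto
qed

lemma lsin_squared_integrable: "(\<lambda>t. (lsin t)\<^sup>2) integrable_on {0..pi}"
proof -
  obtain I where I: "((\<lambda>t. (lsin t)\<^sup>2) has_integral I) {0..pi/2}"
    using lsin_squared_integrable_half by blast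
  from has_integral_reflect_at[OF this, of pi]
  have "((\<lambda>t. (lsin t)\<^sup>2) has_integral I) {pi/2..pi}" by (simp add: lsin_reflect)
  from has_integral_combine[OF _ _ I this] show ?thesis by auto
qed

lemma lsin_squared_integrable_on: "0 \<le> a \<Longrightarrow> b \<le> pi \<Longrightarrow> (\<lambda>t. (lsin t)\<^sup>2) integrable_on {a..b}"
  by (rule integrable_on_subinterval[OF lsin_squared_integrable]) auto

lemma lsin_integrable_on:
  assumes "0 \<le> a" "b \<le> pi" shows "lsin integrable_on {a..b}"
proof (rule measurable_bounded_by_integrable_imp_integrable)
  show "lsin \<in> borel_measurable (lebesgue_on {a..b})"
    by (rule borel_imp_lebesgue_on) measurable
  show "(\<lambda>t. (lsin t)\<^sup>2 + 1) integrable_on {a..b}"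
    by (intro integrable_add lsin_squared_integrable_on assms integrable_const_ivl)
  fix t :: real
  \<comment> \<open>Expanding gives \<open>2 \<bar>l\<bar> \<le> 2 l^2 + 1\<close> for
    \<open>l = lsin t\<close>, so on a bounded interval the square dominates.\<close>
  have "0 \<le> (\<bar>lsin t\<bar> - 1)\<^sup>2 + \<bar>lsin t\<bar>\<^sup>2" by simp
  then show "norm (lsin t) \<le> (lsin t)\<^sup>2 + 1"
    by (simp add: power2_eq_square algebra_simps)
qed auto

text \<open>These are the functions A and S of the introduction. On [0, pi],
  \<open>- lsin_int\<close> is Lobachevsky's function.\<close>

definition lsin_int :: "real \<Rightarrow> real" where "lsin_int x = integral {0..x} lsin"
definition lsin_sq_int :: "real \<Rightarrow> real" where "lsin_sq_int x = integral {0..x} (\<lambda>t. (lsin t)\<^sup>2)"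

lemma has_integral_lsin:
  assumes "0 \<le> a" "a \<le> b" "b \<le> pi"
  shows "(lsin has_integral (lsin_int b - lsin_int a)) {a..b}"
proof -
  have "lsin_int a + integral {a..b} lsin = lsin_int b"
    unfolding lsin_int_def using assms by (intro Henstock_Kurzweil_Integration.integral_combine lsin_integrable_on) auto
  then show ?thesis using lsin_integrable_on[of a b] assms
    by (metis add_diff_cancel_left' integrable_integral)
qed

lemma has_integral_lsin_squared:
  assumes "0 \<le> a" "a \<le> b" "b \<le> pi"
  shows "((\<lambda>t. (lsin t)\<^sup>2) has_integral (lsin_sq_int b - lsin_sq_int a)) {a..b}"
proof -
  have "lsin_sq_int a + integral {a..b} (\<lambda>t. (lsin t)\<^sup>2) = lsin_sq_int b"
    unfolding lsin_sq_int_def using assms by (intro Henstock_Kurzweil_Integration.integral_combine lsin_squared_integrable_on) auto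
  then show ?thesis using lsin_squared_integrable_on[of a b] assms
    by (metis add_diff_cancel_left' integrable_integral)
qed

lemma lsin_int_0 [simp]: "lsin_int 0 = 0" and lsin_sq_int_0 [simp]: "lsin_sq_int 0 = 0"
  by (simp_all add: lsin_int_def lsin_sq_int_def)

section \<open>Reflection and duplication for the integral of the log-sine\<close>

lemma lsin_int_reflect:
  assumes "0 \<le> x" "x \<le> pi" shows "lsin_int (pi - x) = lsin_int pi - lsin_int x"
proof -
  have h1: "((\<lambda>t. lsin (pi - t)) has_integral (lsin_int x - lsin_int 0)) {pi - x..pi - 0}"
    using assms by (intro has_integral_reflect_at has_integral_lsin) auto
  have h2: "(lsin has_integral (lsin_int pi - lsin_int (pi - x))) {pi - x..pi}"
    using assms by (intro has_integral_lsin) auto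
  have "lsin_int x - lsin_int 0 = lsin_int pi - lsin_int (pi - x)"
    using has_integral_unique[OF h1[unfolded lsin_reflect diff_zero] h2] .
  then show ?thesis by simp
qed

text \<open>The factor 2 inside \<open>lsin\<close> makes the duplication formula of the sine
  additive with no constant term; \<open>lsin (pi / 2 - t)\<close> is
  \<open>ln (2 * cos t)\<close>.\<close>

lemma lsin_double:
  assumes "0 < t" "t < pi / 2" shows "lsin (2 * t) = lsin t + lsin (pi / 2 - t)"
proof -
  have "0 < sin t" "0 < cos t" using assms by (auto intro!: sin_gt_zero cos_gt_zero)
  moreover from this have "ln ((2 * sin t) * (2 * cos t)) = ln (2 * sin t) + ln (2 * cos t)"
    by (intro ln_mult_pos) auto
  moreover have "2 * sin (2 * t) = (2 * sin t) * (2 * cos t)" by (subst sin_double) simp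
  moreover have "sin (pi / 2 - t) = cos t" by (simp add: sin_diff)
  ultimately show ?thesis by (simp only: lsin_def)
qed

lemma has_integral_scale2:
  fixes f :: "real \<Rightarrow> real"
  assumes "(f has_integral I) {2*a..2*b}"
  shows "((\<lambda>x. f (2 * x)) has_integral I / 2) {a..b}"
  using has_integral_affinity'[of f I "2*a" "2*b" 2 0] assms
  by (simp add: mult.commute[of "inverse 2"] flip: divide_inverse)

lemma lsin_int_double:
  assumes "0 \<le> x" "x \<le> pi/2"
  shows "lsin_int (2*x) = 2 * (lsin_int x + lsin_int (pi/2) - lsin_int (pi/2 - x))"
proof -
  have h1: "((\<lambda>t. lsin (2 * t)) has_integral (lsin_int (2*x) - lsin_int 0) / 2) {0..x}"
    using assms by (intro has_integral_scale2) (use has_integral_lsin[of 0 "2*x"] in simp)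
  have *: "lsin (2*t) = lsin t + lsin (pi/2 - t)" if "t \<in> {0..x} - {0, pi/2}" for t
    using that assms by (intro lsin_double) auto
  have **: "((\<lambda>t. lsin t + lsin (pi/2 - t)) has_integral (lsin_int x - lsin_int 0) + (lsin_int (pi/2) - lsin_int (pi/2-x))) {0..x}"
    using assms has_integral_reflect_at[OF has_integral_lsin[of "pi/2-x" "pi/2"], of "pi/2"]
    by (intro has_integral_add has_integral_lsin) auto
  have h2: "((\<lambda>t. lsin (2*t)) has_integral (lsin_int x - lsin_int 0) + (lsin_int (pi/2) - lsin_int (pi/2-x))) {0..x}"
    by (rule has_integral_spike_finite[where S = "{0, pi/2}", OF _ * **]) auto
  have "(lsin_int (2*x) - lsin_int 0) / 2 = (lsin_int x - lsin_int 0) + (lsin_int (pi/2) - lsin_int (pi/2-x))"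
    by (rule has_integral_unique[OF h1 h2])
  then show ?thesis by simp
qed

text \<open>Reflection gives A(pi) = 2 A(pi/2) and duplication gives A(pi) = 4 A(pi/2), so both
  values vanish.\<close>

lemma lsin_int_pi_half [simp]: "lsin_int (pi/2) = 0"
proof -
  have "lsin_int (pi/2) = lsin_int pi - lsin_int (pi/2)" using lsin_int_reflect[of "pi/2"] by simp
  moreover have "lsin_int pi = 2 * (lsin_int (pi/2) + lsin_int (pi/2) - lsin_int 0)" using lsin_int_double[of "pi/2"] by simp
  ultimately show ?thesis unfolding lsin_int_0 by argo
qed

lemma lsin_int_pi [simp]: "lsin_int pi = 0"
  using lsin_int_reflect[of "pi/2"] by simp

lemma lsin_int_pi_third: "lsin_int (pi/3) = 2/3 * lsin_int (pi/6)"
proof -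
  \<comment> \<open>The complement of \<open>pi / 6\<close> is also its double, so duplication
    becomes one equation between two values of A.\<close>
  have "lsin_int (pi/3) = 2 * (lsin_int (pi/6) + lsin_int (pi/2) - lsin_int (pi/3))" using lsin_int_double[of "pi/6"] by simp
  then show ?thesis unfolding lsin_int_pi_half by argo
qed

lemma has_integral_half:
  fixes f :: "real \<Rightarrow> real"
  assumes "(f has_integral I) {a / 2..b / 2}"
  shows "((\<lambda>x. f (x / 2)) has_integral 2 * I) {a..b}"
  using has_integral_affinity'[of f I "a/2" "b/2" "1/2" 0] assms
  by (simp add: mult.commute)

section \<open>Boundary values of \<open>Ln (1 - z)\<close> on the unit circle\<close>

lemma one_minus_cis: "1 - cis t = of_real (2 * sin (t / 2)) * exp (\<i> * of_real ((t - pi) / 2))"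
proof -
  have "exp (\<i> * of_real ((t - pi) / 2)) = cis (t / 2 - pi / 2)"
    by (simp add: cis_conv_exp diff_divide_distrib)
  also have "\<dots> = Complex (sin (t / 2)) (- cos (t / 2))"
    by (simp add: complex_eq_iff cos_diff sin_diff)
  finally have "of_real (2 * sin (t / 2)) * exp (\<i> * of_real ((t - pi) / 2))
      = Complex (2 * sin (t / 2) * sin (t / 2)) (- (2 * sin (t / 2) * cos (t / 2)))"
    by (simp add: complex_eq_iff)
  also have "2 * sin (t / 2) * cos (t / 2) = sin t"
    using sin_double[of "t / 2"] by simp
  also have "2 * sin (t / 2) * sin (t / 2) = 1 - cos t"
    using cos_double_sin[of "t / 2"] by (simp add: power2_eq_square)
  finally show ?thesis by (simp add: complex_eq_iff)
qed

text \<open>The angle \<open>(t - pi) / 2\<close> of the polar form lies strictly between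
  \<open>- pi / 2\<close> and \<open>pi / 2\<close>, so the principal branch returns it
  unchanged.\<close>

lemma Ln_one_minus_cis:
  assumes "0 < t" "t < 2 * pi"
  shows "Ln (1 - cis t) = Complex (lsin (t / 2)) ((t - pi) / 2)"
proof -
  have s: "0 < sin (t / 2)" using assms by (intro sin_gt_zero) auto
  have "Ln (1 - cis t) = of_real (ln (2 * sin (t / 2))) + Ln (exp (\<i> * of_real ((t - pi) / 2)))"
    unfolding one_minus_cis using s Ln_of_real[of "2 * sin (t / 2)"] by (subst Ln_times_of_real) auto
  also have "Ln (exp (\<i> * of_real ((t - pi) / 2))) = \<i> * of_real ((t - pi) / 2)"
    using assms by (intro Ln_exp) (auto simp: field_simps)
  finally show ?thesis by (simp add: complex_eq_iff lsin_def)
qed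

lemma norm_one_minus_cis:
  assumes "0 \<le> t" "t \<le> 2 * pi"
  shows "cmod (1 - cis t) = 2 * sin (t / 2)"
  unfolding one_minus_cis using assms by (auto simp: norm_mult sin_ge_zero)

text \<open>A majorant independent of R, for dominated convergence. With w the argument of
  \<open>Ln\<close>, \<open>\<bar>1 - cis t\<bar> \<le> \<bar>w\<bar> + (1 - R) \<le> 2
  \<bar>w\<bar>\<close>, hence \<open>sin (t / 2) \<le> \<bar>w\<bar> \<le> 2\<close>. The constant
  5 is 1 for \<open>ln 2\<close> plus 4 for the imaginary part, which is at most pi in absolute
  value.\<close>

lemma Ln_radial_bound:
  assumes "0 < t" "t \<le> pi" "0 < R" "R < 1"
  shows "cmod (Ln (1 - of_real R * cis t)) \<le> \<bar>lsin (t / 2)\<bar> + 5"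
proof -
  let ?w = "1 - of_real R * cis t"
  have s: "0 < sin (t / 2)" using assms by (intro sin_gt_zero) auto
  have "cis t = of_real (1 - R) * cis t + of_real R * cis t"
    by (simp add: algebra_simps)
  then have "1 - cis t = ?w - of_real (1 - R) * cis t" by (simp add: algebra_simps)
  then have "cmod (1 - cis t) \<le> cmod ?w + cmod (of_real (1 - R) * cis t)"
    by (simp only: norm_triangle_ineq4)
  then have "2 * sin (t / 2) \<le> cmod ?w + cmod (of_real (1 - R) * cis t)"
    using norm_one_minus_cis[of t] assms by simp
  also have "cmod (of_real (1 - R) * cis t) = 1 - R"
    using assms by (simp only: norm_mult norm_cis norm_of_real) simp
  also have "1 - R \<le> cmod ?w"
    using norm_triangle_ineq2[of 1 "of_real R * cis t"] assms by (simp add: norm_mult)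
  finally have l: "sin (t / 2) \<le> cmod ?w" by simp
  have u: "cmod ?w \<le> 2"
    using norm_triangle_ineq4[of 1 "of_real R * cis t"] assms by (simp add: norm_mult)
  have w0: "?w \<noteq> 0" "0 < cmod ?w" using l s by auto
  have "lsin (t / 2) = ln 2 + ln (sin (t / 2))" unfolding lsin_def using s by (intro ln_mult_pos) auto
  moreover have "ln (sin (t / 2)) \<le> ln (cmod ?w)" "ln (cmod ?w) \<le> ln 2"
    using l u s w0 by (auto intro!: ln_mono)
  moreover have "0 < ln (2::real)" "ln (2::real) \<le> 1" using ln_le_minus_one[of "2::real"] by auto
  ultimately have "\<bar>ln (cmod ?w)\<bar> \<le> \<bar>lsin (t / 2)\<bar> + 1" by linarith
  moreover have "\<bar>Im (Ln ?w)\<bar> \<le> 4"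
    using mpi_less_Im_Ln[OF w0(1)] Im_Ln_le_pi[OF w0(1)] pi_less_4 by linarith
  ultimately show ?thesis
    using cmod_le[of "Ln ?w"] Re_Ln[OF w0(1)] by linarith
qed

text \<open>
  Along the circle of radius R < 1 the identity is the fundamental theorem of calculus,
  since d/dt G(R cis t) = i q(Ln (1 - R cis t)); then R tends to 1 under dominated convergence.
\<close>
lemma radial_limit:
  fixes q G :: "complex \<Rightarrow> complex"
  assumes \<sigma>: "0 < \<sigma>" "\<sigma> \<le> pi"
    and G: "\<And>z. z \<noteq> 0 \<Longrightarrow> cmod z < 1 \<Longrightarrow> (G has_field_derivative q (Ln (1 - z)) / z) (at z)"
    and G_real: "\<And>R. 0 < R \<Longrightarrow> R < 1 \<Longrightarrow> Im (G (of_real R)) = 0"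
    and q: "continuous_on UNIV q" "\<And>w. cmod (q w) \<le> (cmod w)\<^sup>2 + 1"
    and lim: "(\<lambda>n. G (of_real (1 - 1 / (real n + 2)) * cis \<sigma>)) \<longlonglongrightarrow> L"
  shows "((\<lambda>t. Re (q (Complex (lsin (t / 2)) ((t - pi) / 2)))) has_integral Im L) {0..\<sigma>}"
proof -
  define R where "R n = 1 - 1 / (real n + 2)" for n
  have R: "0 < R n" "R n < 1" for n by (auto simp: R_def field_simps)
  let ?f = "\<lambda>n t. Re (q (Ln (1 - of_real (R n) * cis t)))"
  let ?g = "\<lambda>t. Re (q (Complex (lsin (t / 2)) ((t - pi) / 2)))"
  have qlim: "((\<lambda>x. q (f x)) \<longlongrightarrow> q l) F" if "(f \<longlongrightarrow> l) F" for f :: "nat \<Rightarrow> complex" and l F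
    using continuous_on_tendsto_compose[OF q(1) that] by simp
  have f: "(?f n has_integral Im (G (of_real (R n) * cis \<sigma>))) {0<..<\<sigma>}" for n
  proof -
    have "((\<lambda>t. \<i> * q (Ln (1 - of_real (R n) * cis t))) has_integral
            (G (of_real (R n) * cis \<sigma>) - G (of_real (R n) * cis 0))) {0..\<sigma>}"
    proof (rule fundamental_theorem_of_calculus)
      fix t assume "t \<in> {0..\<sigma>}"
      let ?z = "of_real (R n) * cis t"
      have z: "?z \<noteq> 0" "cmod ?z < 1" using R[of n] by (auto simp: norm_mult)
      have "((\<lambda>t. of_real (R n) * cis t) has_vector_derivative (\<i> * ?z)) (at t within {0..\<sigma>})"
        unfolding has_vector_derivative_def
        by (auto intro!: derivative_eq_intros simp: fun_eq_iff scaleR_conv_of_real)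
      from field_vector_diff_chain_within[OF this has_field_derivative_at_within[OF G[OF z]]]
      have "(G \<circ> (\<lambda>t. of_real (R n) * cis t) has_vector_derivative \<i> * ?z * (q (Ln (1 - ?z)) / ?z)) (at t within {0..\<sigma>})" .
      moreover have "\<i> * ?z * (q (Ln (1 - ?z)) / ?z) = \<i> * q (Ln (1 - ?z))" using z(1) by simp
      ultimately show "((\<lambda>t. G (of_real (R n) * cis t)) has_vector_derivative \<i> * q (Ln (1 - ?z))) (at t within {0..\<sigma>})"
        by (simp add: o_def)
    qed (use \<sigma> in auto)
    \<comment> \<open>The arc starts at the real point \<open>R n\<close>, where G has imaginary
      part 0, so only the upper endpoint contributes.\<close>
    from has_integral_linear[OF this bounded_linear_Im] show ?thesis
      using G_real[OF R, of n] by (simp add: o_def has_integral_Icc_iff_Ioo)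
  qed
  \<comment> \<open>The growth bound on q and \<open>Ln_radial_bound\<close> give
    \<open>(\<bar>l\<bar> + 5)^2 + 1\<close> with \<open>l = lsin (t / 2)\<close>, which is at most
    \<open>2 l^2 + 51\<close> because \<open>(\<bar>l\<bar> - 5)^2 \<ge> 0\<close>.\<close>
  have h: "(\<lambda>t. 2 * (lsin (t / 2))\<^sup>2 + 51) integrable_on {0<..<\<sigma>}"
  proof -
    have "((\<lambda>t. (lsin t)\<^sup>2) has_integral (lsin_sq_int (\<sigma> / 2) - lsin_sq_int (0/2))) {0/2..\<sigma> / 2}"
      using \<sigma> by (intro has_integral_lsin_squared) auto
    from has_integral_half[OF this] have "(\<lambda>t. (lsin (t / 2))\<^sup>2) integrable_on {0..\<sigma>}" by blast
    then have "(\<lambda>t. 2 * (lsin (t / 2))\<^sup>2 + 51) integrable_on {0..\<sigma>}"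
      by (intro integrable_add integrable_on_mult_right integrable_const_ivl)
    then show ?thesis by (simp add: integrable_on_Icc_iff_Ioo)
  qed
  have le: "norm (?f n t) \<le> 2 * (lsin (t / 2))\<^sup>2 + 51" if t: "t \<in> {0<..<\<sigma>}" for n t
  proof -
    have "norm (?f n t) \<le> cmod (q (Ln (1 - of_real (R n) * cis t)))"
      using abs_Re_le_cmod by simp
    also have "\<dots> \<le> (cmod (Ln (1 - of_real (R n) * cis t)))\<^sup>2 + 1" by (rule q)
    also have "\<dots> \<le> (\<bar>lsin (t / 2)\<bar> + 5)\<^sup>2 + 1"
      using Ln_radial_bound[of t "R n"] t \<sigma> R[of n] by (intro add_mono power_mono) auto
    also have "\<dots> \<le> 2 * (lsin (t / 2))\<^sup>2 + 51"
      using zero_le_power2[of "\<bar>lsin (t / 2)\<bar> - 5"] by (simp add: power2_eq_square algebra_simps)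
    finally show ?thesis .
  qed
  have conv: "(\<lambda>n. ?f n t) \<longlonglongrightarrow> ?g t" if t: "t \<in> {0<..<\<sigma>}" for t
  proof -
    \<comment> \<open>The limit point \<open>1 - cis t\<close> has positive real part, so it stays
      off the cut of \<open>Ln\<close>.\<close>
    have "cos t < cos 0" using t \<sigma> by (intro cos_monotone_0_pi) auto
    then have "1 - of_real 1 * cis t \<notin> \<real>\<^sub>\<le>\<^sub>0" by (auto simp: complex_nonpos_Reals_iff)
    moreover have "R \<longlonglongrightarrow> 1" unfolding R_def by real_asymp
    ultimately have "(\<lambda>n. Re (q (Ln (1 - of_real (R n) * cis t)))) \<longlonglongrightarrow> Re (q (Ln (1 - of_real 1 * cis t)))"
      by (intro tendsto_intros qlim)
    then show ?thesis using Ln_one_minus_cis[of t] t \<sigma> by simp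
  qed
  note dc = dominated_convergence[OF has_integral_integrable[OF f] h le conv]
  have "(\<lambda>n. integral {0<..<\<sigma>} (?f n)) \<longlonglongrightarrow> Im L"
    unfolding integral_unique[OF f] using tendsto_Im[OF lim] unfolding R_def .
  from LIMSEQ_unique[OF this dc(2)] have "Im L = integral {0<..<\<sigma>} ?g" .
  then have "(?g has_integral Im L) {0<..<\<sigma>}"
    using integrable_integral[OF dc(1)] by (simp only:)
  then show ?thesis by (simp add: has_integral_Icc_iff_Ioo)
qed

section \<open>Special values of the squared log-sine integral\<close>

text \<open>The half plane is convex and \<open>1 - z\<close> avoids the cut there, so a primitive
  exists once the singularity at 0 is removed. Normalised to vanish at 0, it is real on the real
  axis because its derivative is real there.\<close>

lemma primitive_Ln_squared:
  obtains G :: "complex \<Rightarrow> complex" where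
    "\<And>z. Re z < 1 \<Longrightarrow> (G has_field_derivative (Ln (1 - z))\<^sup>2 / z) (at z)"
    "\<And>x. x < 1 \<Longrightarrow> Im (G (of_real x)) = 0"
proof -
  let ?S = "{z. Re z < 1}"
  let ?h = "\<lambda>z. (Ln (1 - z))\<^sup>2 / z"
  have S: "convex ?S" "open ?S" by (auto simp: convex_halfspace_Re_lt open_halfspace_Re_lt)
  have nr: "1 - z \<notin> \<real>\<^sub>\<le>\<^sub>0" if "Re z < 1" for z using that by (auto simp: complex_nonpos_Reals_iff)
  have diff: "?h field_differentiable at z" if "Re z < 1" "z \<noteq> 0" for z
    using that nr[of z] unfolding field_differentiable_def
    by (intro exI) (rule derivative_eq_intros refl | simp)+
  have "((\<lambda>z. Ln (1 - z)) has_field_derivative -1) (at 0)"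
    by (auto intro!: derivative_eq_intros)
  then have "((\<lambda>z. Ln (1 - z) / z) \<longlongrightarrow> -1) (at 0)"
    by (simp add: has_field_derivative_iff)
  moreover have "((\<lambda>z. Ln (1 - z)) \<longlongrightarrow> Ln (1 - 0)) (at 0)"
    by (intro tendsto_intros) auto
  ultimately have "((\<lambda>z. Ln (1 - z) * (Ln (1 - z) / z)) \<longlongrightarrow> Ln (1 - 0) * -1) (at 0)"
    by (intro tendsto_mult)
  \<comment> \<open>The limit is 0, which is also the value of \<open>?h\<close> at 0 by the
    convention \<open>x / 0 = 0\<close>.\<close>
  then have "isCont ?h 0" by (simp add: isCont_def power2_eq_square)
  then have "continuous_on ?S ?h"
    using field_differentiable_imp_continuous_at[OF diff]
    by (intro continuous_at_imp_continuous_on) (metis mem_Collect_eq)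
  \<comment> \<open>At the exceptional point 0 the primitive theorem asks for continuity
    only.\<close>
  then obtain F where F: "\<And>z. z \<in> ?S \<Longrightarrow> (F has_field_derivative ?h z) (at z within ?S)"
    using holomorphic_convex_primitive[of ?S "{0}" ?h] S diff by (auto simp: interior_open)
  define G where "G z = F z - F 0" for z
  have G: "(G has_field_derivative ?h z) (at z)" if "Re z < 1" for z
    unfolding G_def using F[of z] that S(2) at_within_open[of z ?S]
    by (auto intro!: derivative_eq_intros)
  have "Im (G (of_real x)) = Im (G (of_real 0))" if "x < 1" for x
  proof -
    have "((\<lambda>x. Im (G (of_real x))) has_real_derivative 0) (at y within {..<1})" if "y \<in> {..<1}" for y
    proof -
      have "((\<lambda>x. of_real x :: complex) has_vector_derivative 1) (at y within {..<1})"
        by (simp add: has_vector_derivative_def bounded_linear_imp_has_derivative bounded_linear_of_real scaleR_conv_of_real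
              bounded_linear_imp_has_derivative[of of_real, unfolded of_real_def])
      from field_vector_diff_chain_within[OF this has_field_derivative_at_within[OF G]] that
      have "(G \<circ> of_real has_vector_derivative ?h (of_real y)) (at y within {..<1})" by simp
      moreover have "Im (?h (of_real y)) = 0"
      proof -
        have "Ln (1 - of_real y) = of_real (ln (1 - y))"
          using that Ln_of_real[of "1 - y"] by simp
        then have "?h (of_real y) = of_real ((ln (1 - y))\<^sup>2 / y)" by simp
        then show ?thesis by (simp only: Im_complex_of_real)
      qed
      ultimately show ?thesis
        using bounded_linear.has_vector_derivative[OF bounded_linear_Im, of "G \<circ> of_real"]
        unfolding has_real_derivative_iff_has_vector_derivative o_def by metis
    qed
    from has_field_derivative_zero_constant[OF _ this]
    obtain c where "\<And>x. x \<in> {..<1} \<Longrightarrow> Im (G (of_real x)) = c" by auto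
    from this[of x] this[of 0] show ?thesis using that by simp
  qed
  then show ?thesis using G that[of G] by (simp add: G_def)
qed

text \<open>\<open>radial_limit\<close> with \<open>q w = w^2\<close> integrates the real part
  \<open>(lsin (t / 2))^2 - ((t - pi) / 2)^2\<close>. Adding back the polynomial produces the cubic
  terms, and the substitution \<open>t / 2\<close> a factor 1/2.\<close>

lemma lsin_sq_int_half_eq:
  assumes \<sigma>: "0 < \<sigma>" "\<sigma> \<le> pi"
    and G: "\<And>z. Re z < 1 \<Longrightarrow> (G has_field_derivative (Ln (1 - z))\<^sup>2 / z) (at z)"
    and G_real: "\<And>x. x < 1 \<Longrightarrow> Im (G (of_real x)) = 0"
  shows "lsin_sq_int (\<sigma> / 2) = Im (G (cis \<sigma>)) / 2 + ((\<sigma> - pi) ^ 3 + pi ^ 3) / 24"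
proof -
  have "cos \<sigma> < cos 0" using \<sigma> by (intro cos_monotone_0_pi) auto
  then have "isCont G (cis \<sigma>)" using G[of "cis \<sigma>"] by (intro DERIV_isCont) auto
  moreover have "(\<lambda>n. of_real (1 - 1 / (real n + 2)) * cis \<sigma>) \<longlonglongrightarrow> of_real 1 * cis \<sigma>"
    by (intro tendsto_intros) real_asymp
  ultimately have "(\<lambda>n. G (of_real (1 - 1 / (real n + 2)) * cis \<sigma>)) \<longlonglongrightarrow> G (cis \<sigma>)"
    by (intro isCont_tendsto_compose[of _ G]) auto
  then have "((\<lambda>t. Re ((Complex (lsin (t / 2)) ((t - pi) / 2))\<^sup>2)) has_integral Im (G (cis \<sigma>))) {0..\<sigma>}"
  proof (rule radial_limit[OF \<sigma>, rotated -1])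
    fix z :: complex assume "cmod z < 1"
    then show "(G has_field_derivative (Ln (1 - z))\<^sup>2 / z) (at z)"
      using complex_Re_le_cmod[of z] by (intro G) linarith
  qed (use G_real in \<open>auto simp: norm_power intro!: continuous_intros\<close>)
  moreover have "((\<lambda>t. ((t - pi) / 2)\<^sup>2) has_integral ((\<sigma> - pi) ^ 3 / 12 - (0 - pi) ^ 3 / 12)) {0..\<sigma>}"
    using \<sigma> by (intro fundamental_theorem_of_calculus)
      (auto intro!: derivative_eq_intros simp: power2_eq_square field_simps
            simp flip: has_real_derivative_iff_has_vector_derivative)
  ultimately have "((\<lambda>t. Re ((Complex (lsin (t / 2)) ((t - pi) / 2))\<^sup>2) + ((t - pi) / 2)\<^sup>2) has_integral
      (Im (G (cis \<sigma>)) + ((\<sigma> - pi) ^ 3 / 12 - (0 - pi) ^ 3 / 12))) {0..\<sigma>}"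
    by (rule has_integral_add)
  then have h1: "((\<lambda>t. (lsin (t / 2))\<^sup>2) has_integral
      (Im (G (cis \<sigma>)) + ((\<sigma> - pi) ^ 3 / 12 - (0 - pi) ^ 3 / 12))) {0..\<sigma>}"
    by (simp add: power2_eq_square)
  have h2: "((\<lambda>t. (lsin (t / 2))\<^sup>2) has_integral 2 * (lsin_sq_int (\<sigma> / 2) - lsin_sq_int (0 / 2))) {0..\<sigma>}"
    using \<sigma> by (intro has_integral_half[of "\<lambda>t. (lsin t)\<^sup>2"] has_integral_lsin_squared) auto
  show ?thesis using has_integral_unique[OF h1 h2] by (simp add: field_simps)
qed

lemma lsin_sq_int_pi_half: "lsin_sq_int (pi / 2) = pi ^ 3 / 24"
proof -
  obtain G where G: "\<And>z. Re z < 1 \<Longrightarrow> (G has_field_derivative (Ln (1 - z))\<^sup>2 / z) (at z)"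
    "\<And>x. x < 1 \<Longrightarrow> Im (G (of_real x)) = 0" by (rule primitive_Ln_squared) blast
  have "lsin_sq_int (pi / 2) = Im (G (cis pi)) / 2 + ((pi - pi) ^ 3 + pi ^ 3) / 24"
    by (rule lsin_sq_int_half_eq[OF _ _ G]) auto
  then show ?thesis using G(2)[of "-1"] by simp
qed

text \<open>
  The imaginary part of the primitive at exp (i pi / 3) is computed along the arc
  z = 1 - exp (- i psi), on which Ln (1 - z) = - i psi.
\<close>
lemma lsin_sq_int_pi_sixth: "lsin_sq_int (pi / 6) = 7 * pi ^ 3 / 216"
proof -
  obtain G where G: "\<And>z. Re z < 1 \<Longrightarrow> (G has_field_derivative (Ln (1 - z))\<^sup>2 / z) (at z)"
    "\<And>x. x < 1 \<Longrightarrow> Im (G (of_real x)) = 0" by (rule primitive_Ln_squared) blast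
  have "((\<lambda>p. p\<^sup>2 / 2) has_integral (Im (G (1 - cis (- (pi / 3)))) - Im (G (1 - cis (- 0))))) {0..pi / 3}"
  proof (rule fundamental_theorem_of_calculus)
    fix p assume p: "p \<in> {0..pi / 3}"
    have "- (pi / 2) < p" "p < pi / 2" using p pi_gt_zero by (simp_all only: atLeastAtMost_iff) linarith+
    then have "0 < cos p" by (rule cos_gt_zero_pi)
    then have "Re (1 - cis (- p)) < 1" by simp
    have "((\<lambda>p. 1 - cis (- p)) has_vector_derivative (\<i> * cis (- p))) (at p within {0..pi / 3})"
      unfolding has_vector_derivative_def
      by (auto intro!: derivative_eq_intros simp: fun_eq_iff scaleR_conv_of_real)
    from field_vector_diff_chain_within[OF this has_field_derivative_at_within[OF G(1)]] \<open>Re _ < 1\<close>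
    have "(G \<circ> (\<lambda>p. 1 - cis (- p)) has_vector_derivative
        \<i> * cis (- p) * ((Ln (1 - (1 - cis (- p))))\<^sup>2 / (1 - cis (- p)))) (at p within {0..pi / 3})" by simp
    moreover have "\<bar>p\<bar> < pi" using \<open>p < pi / 2\<close> \<open>- (pi / 2) < p\<close> by linarith
    moreover from this have "Ln (1 - (1 - cis (- p))) = - \<i> * of_real p"
    proof -
      have "Ln (exp (- \<i> * of_real p)) = - \<i> * of_real p"
        using \<open>\<bar>p\<bar> < pi\<close> by (intro Ln_exp) auto
      then show ?thesis by (simp add: cis_conv_exp)
    qed
    \<comment> \<open>The real part of \<open>cis (- p) / (1 - cis (- p))\<close> is the constant
      \<open>- 1 / 2\<close>, and the remaining factor is \<open>- \<i> * p^2\<close>. At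
      \<open>p = 0\<close> both sides are 0.\<close>
    moreover have "Im (\<i> * cis (- p) * ((- \<i> * of_real p)\<^sup>2 / (1 - cis (- p)))) = p\<^sup>2 / 2"
    proof (cases "p = 0")
      case False
      have "cos p < cos 0" using p False by (intro cos_monotone_0_pi) auto
      then have c: "cos p \<noteq> 1" by simp
      then have n: "1 - cis (- p) \<noteq> 0" by (auto simp: complex_eq_iff)
      have "sin p * sin p = (1 - cos p) * (1 + cos p)"
        using sin_cos_squared_add[of p] by (simp add: power2_eq_square algebra_simps)
      then have "sin p * sin p / (1 - cos p) = 1 + cos p" using c by simp
      then have "cis (- p) = Complex (- (1 / 2)) (- sin p / (2 * (1 - cos p))) * (1 - cis (- p))"
        using c by (simp add: complex_eq_iff divide_simps) (simp add: algebra_simps)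
      then have "cis (- p) / (1 - cis (- p)) = Complex (- (1 / 2)) (- sin p / (2 * (1 - cos p)))"
        using n by (simp only: divide_eq_eq) simp
      moreover have "\<i> * cis (- p) * ((- \<i> * of_real p)\<^sup>2 / (1 - cis (- p)))
          = - \<i> * (of_real p)\<^sup>2 * (cis (- p) / (1 - cis (- p)))"
        by (simp add: power_mult_distrib)
      ultimately have "\<i> * cis (- p) * ((- \<i> * of_real p)\<^sup>2 / (1 - cis (- p)))
          = - \<i> * (of_real p)\<^sup>2 * Complex (- (1 / 2)) (- sin p / (2 * (1 - cos p)))"
        by (simp only:)
      then show ?thesis by (simp add: power2_eq_square)
    qed auto
    ultimately have "(G \<circ> (\<lambda>p. 1 - cis (- p)) has_vector_derivative
        \<i> * cis (- p) * ((- \<i> * of_real p)\<^sup>2 / (1 - cis (- p)))) (at p within {0..pi / 3})"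
      and e: "Im (\<i> * cis (- p) * ((- \<i> * of_real p)\<^sup>2 / (1 - cis (- p)))) = p\<^sup>2 / 2"
      by (simp_all only:)
    from bounded_linear.has_vector_derivative[OF bounded_linear_Im this(1)]
    show "((\<lambda>p. Im (G (1 - cis (- p)))) has_vector_derivative p\<^sup>2 / 2) (at p within {0..pi / 3})"
      unfolding e o_def .
  qed simp
  moreover have "((\<lambda>p. p\<^sup>2 / 2) has_integral ((pi / 3) ^ 3 / 6 - 0 ^ 3 / 6)) {0..pi / 3}"
    by (intro fundamental_theorem_of_calculus)
      (auto intro!: derivative_eq_intros simp: power2_eq_square field_simps
            simp flip: has_real_derivative_iff_has_vector_derivative)
  ultimately have "Im (G (1 - cis (- (pi / 3)))) - Im (G (1 - cis (- 0))) = (pi / 3) ^ 3 / 6 - 0 ^ 3 / 6"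
    by (rule has_integral_unique)
  \<comment> \<open>The arc ends where the circles \<open>\<bar>1 - z\<bar> = 1\<close> and
    \<open>\<bar>z\<bar> = 1\<close> meet in the upper half plane; it starts at 0, where G is
    real.\<close>
  moreover have "1 - cis (- (pi / 3)) = cis (pi / 3)"
    by (simp add: complex_eq_iff cos_60)
  ultimately have "Im (G (cis (pi / 3))) = (pi / 3) ^ 3 / 6" using G(2)[of 0] by simp
  moreover have "lsin_sq_int (pi / 3 / 2) = Im (G (cis (pi / 3))) / 2 + ((pi / 3 - pi) ^ 3 + pi ^ 3) / 24"
    by (rule lsin_sq_int_half_eq[OF _ _ G]) auto
  ultimately show ?thesis by (simp add: power3_eq_cube field_simps)
qed

section \<open>The dilogarithm\<close>

text \<open>Generic in the type, since circle means use real arguments and the Clausen function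
  complex ones.\<close>

definition Li2 :: "'a::{real_normed_field,banach} \<Rightarrow> 'a" where
  "Li2 z = (\<Sum>n. z ^ Suc n / of_nat (Suc n) ^ 2)"

lemma summable_Suc_inverse_squares: "summable (\<lambda>n. 1 / (real (Suc n))\<^sup>2)"
  using inverse_squares_sums by (simp add: sums_iff add.commute)

lemma norm_Li2_term_le:
  fixes z :: "'a::{real_normed_field,banach}"
  assumes "norm z \<le> 1"
  shows "norm (z ^ Suc n / of_nat (Suc n) ^ 2) \<le> 1 / (real (Suc n))\<^sup>2"
proof -
  have "norm z ^ Suc n \<le> 1" using assms by (intro power_le_one) auto
  then show ?thesis by (simp add: norm_divide norm_power norm_mult divide_right_mono del: of_nat_Suc power_Suc)
qed

lemma summable_Li2:
  fixes z :: "'a::{real_normed_field,banach}"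
  assumes "norm z \<le> 1"
  shows "summable (\<lambda>n. z ^ Suc n / of_nat (Suc n) ^ 2)"
  by (rule summable_comparison_test'[OF summable_Suc_inverse_squares norm_Li2_term_le[OF assms]])

text \<open>The majorant \<open>1 / (n + 1)^2\<close> is valid on the closed disc, so continuity
  includes the boundary points 1 and \<open>cis \<sigma>\<close> that are used later.\<close>

lemma continuous_on_Li2: "continuous_on (cball 0 1) (Li2 :: 'a::{real_normed_field,banach} \<Rightarrow> 'a)"
proof (rule uniform_limit_theorem)
  show "uniform_limit (cball 0 1) (\<lambda>n z. \<Sum>i<n. z ^ Suc i / of_nat (Suc i) ^ 2) (Li2 :: 'a \<Rightarrow> 'a) sequentially"
    unfolding Li2_def
    by (rule Weierstrass_m_test[OF norm_Li2_term_le summable_Suc_inverse_squares]) (simp add: dist_norm)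
qed (auto intro!: always_eventually continuous_intros simp del: of_nat_Suc power_Suc)

lemma Li2_0 [simp]: "Li2 0 = 0"
  by (simp add: Li2_def)

lemma Li2_of_real: "\<bar>x\<bar> \<le> 1 \<Longrightarrow> Li2 (complex_of_real x) = of_real (Li2 x)"
  unfolding Li2_def using summable_Li2[of x] by (simp add: suminf_of_real del: of_nat_Suc power_Suc)

lemma has_field_derivative_Li2_series:
  fixes z :: "'a::{real_normed_field,banach}"
  assumes "norm z < 1"
  shows "(Li2 has_field_derivative (\<Sum>n. z ^ n / of_nat (Suc n))) (at z)"
proof -
  \<comment> \<open>By the division convention \<open>c 0 = 0\<close>, so the power series indexed
    from 0 is the series of \<open>Li2\<close>.\<close>
  define c where "c n = (1 / of_nat n ^ 2 :: 'a)" for n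
  have "summable (\<lambda>n. c (Suc n) * 1 ^ Suc n)"
    using summable_Li2[of "1::'a"] by (simp add: c_def del: of_nat_Suc)
  then have s: "summable (\<lambda>n. c n * 1 ^ n)" by (subst (asm) summable_Suc_iff)
  from termdiffs_strong[OF s, of z] assms
  have "((\<lambda>x. \<Sum>n. c n * x ^ n) has_field_derivative (\<Sum>n. diffs c n * z ^ n)) (at z)" by simp
  moreover have "(\<Sum>n. c n * w ^ n) = Li2 w" if "w \<in> ball 0 1" for w
  proof -
    have "summable (\<lambda>n. c (Suc n) * w ^ Suc n)"
      using summable_Li2[of w] that by (simp add: c_def dist_norm mult.commute del: of_nat_Suc)
    then have "summable (\<lambda>n. c n * w ^ n)" by (subst (asm) summable_Suc_iff)
    from suminf_split_head[OF this] have "(\<Sum>n. c n * w ^ n) = (\<Sum>n. c (Suc n) * w ^ Suc n)"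
      by (simp add: c_def)
    then show ?thesis by (simp add: c_def Li2_def del: of_nat_Suc)
  qed
  moreover have "diffs c n * z ^ n = z ^ n / of_nat (Suc n)" for n
    by (simp add: diffs_def c_def power2_eq_square del: of_nat_Suc)
  ultimately show ?thesis
    using has_field_derivative_transform_within_open[of _ _ z "ball 0 1" Li2] assms by simp
qed

text \<open>Multiplied by \<open>- x\<close>, the derived series is the logarithmic series of
  \<open>ln (1 - x)\<close>. The point 0 is left out because the closed form evaluates to 0 there,
  while the derivative is 1.\<close>

lemma has_real_derivative_Li2:
  fixes x :: real
  assumes "\<bar>x\<bar> < 1" "x \<noteq> 0"
  shows "(Li2 has_real_derivative - ln (1 - x) / x) (at x)"
proof -
  have "ln (1 - x) = (\<Sum>n. (-1) ^ n * (1 / real (n + 1)) * (1 - x - 1) ^ Suc n)"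
    using assms by (intro ln_series) auto
  also have "(\<lambda>n. (-1) ^ n * (1 / real (n + 1)) * (1 - x - 1) ^ Suc n) = (\<lambda>n. - x * (x ^ n / real (Suc n)))"
  proof
    fix n
    have "(-1) ^ n * (- x) ^ n = x ^ n" by (simp flip: power_mult_distrib)
    then show "(-1) ^ n * (1 / real (n + 1)) * (1 - x - 1) ^ Suc n = - x * (x ^ n / real (Suc n))"
      by (simp add: divide_simps mult_ac)
  qed
  also have "(\<Sum>n. - x * (x ^ n / real (Suc n))) = - x * (\<Sum>n. x ^ n / real (Suc n))"
  proof (rule suminf_mult)
    show "summable (\<lambda>n. x ^ n / real (Suc n))"
    proof (rule summable_comparison_test'[of "\<lambda>n. \<bar>x\<bar> ^ n" 0])
      show "norm (x ^ n / real (Suc n)) \<le> \<bar>x\<bar> ^ n" for n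
        by (simp add: power_abs divide_le_eq mult_le_cancel_left1)
    qed (use assms in auto)
  qed
  finally show ?thesis using has_field_derivative_Li2_series[of x] assms by simp
qed

lemma has_field_derivative_Li2_complex:
  fixes z :: complex
  assumes "cmod z < 1" "z \<noteq> 0"
  shows "(Li2 has_field_derivative - Ln (1 - z) / z) (at z)"
proof -
  have "(\<lambda>n. - (z ^ n) / of_nat n) sums Ln (1 - z)"
    using Ln_series'[of "- z"] assms by simp
  then have "(\<lambda>n. - (z ^ Suc n) / of_nat (Suc n)) sums Ln (1 - z)"
    by (subst sums_Suc_iff) simp
  from sums_mult[OF this, of "- inverse z"]
  have "(\<lambda>n. z ^ n / of_nat (Suc n)) sums (- Ln (1 - z) / z)"
    using assms by (simp add: field_simps del: of_nat_Suc)
  then show ?thesis using has_field_derivative_Li2_series[of z] assms by (simp add: sums_iff)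
qed

lemma Li2_1: "Li2 (1::real) = pi\<^sup>2 / 6"
  using inverse_squares_sums by (simp add: Li2_def sums_iff add.commute)

lemma Li2_bounds:
  assumes "0 \<le> x" "x \<le> (1::real)" shows "0 \<le> Li2 x" "Li2 x \<le> pi\<^sup>2 / 6"
proof -
  show "0 \<le> Li2 x" unfolding Li2_def using summable_Li2[of x] assms by (intro suminf_nonneg) auto
  have "Li2 x \<le> Li2 1" unfolding Li2_def using summable_Li2[of x] summable_Li2[of "1::real"] assms
    by (intro suminf_le) (auto intro!: divide_right_mono power_le_one mult_le_one simp del: of_nat_Suc)
  then show "Li2 x \<le> pi\<^sup>2 / 6" by (simp add: Li2_1)
qed

text \<open>The Clausen function is the imaginary part of \<open>Li2\<close> on the unit circle.
  \<open>radial_limit\<close> with \<open>G = Li2\<close> and \<open>q w = - w\<close> turns it into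
  an integral of \<open>- lsin (t / 2)\<close>.\<close>

lemma Cl2_eq_lsin_int:
  assumes \<sigma>: "0 < \<sigma>" "\<sigma> \<le> pi"
  shows "Cl2 \<sigma> = - 2 * lsin_int (\<sigma> / 2)"
proof -
  have "(\<lambda>n. of_real (1 - 1 / (real n + 2)) * cis \<sigma>) \<longlonglongrightarrow> of_real 1 * cis \<sigma>"
    by (intro tendsto_intros) real_asymp
  then have "(\<lambda>n. Li2 (of_real (1 - 1 / (real n + 2)) * cis \<sigma>)) \<longlonglongrightarrow> Li2 (cis \<sigma>)"
  proof (intro continuous_on_tendsto_compose[OF continuous_on_Li2])
    have "cmod (of_real (1 - 1 / (real n + 2)) * cis \<sigma>) \<le> 1" for n
      unfolding norm_mult norm_cis norm_of_real by (auto simp: field_simps)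
    then show "\<forall>\<^sub>F n in sequentially. of_real (1 - 1 / (real n + 2)) * cis \<sigma> \<in> cball 0 1"
      by (simp only: mem_cball dist_0_norm) simp
  qed auto
  then have "((\<lambda>t. Re (- Complex (lsin (t / 2)) ((t - pi) / 2))) has_integral Im (Li2 (cis \<sigma>))) {0..\<sigma>}"
  proof (rule radial_limit[OF \<sigma>, rotated -1])
    show "cmod (- w) \<le> (cmod w)\<^sup>2 + 1" for w
      using zero_le_power2[of "cmod w - 1"] norm_ge_zero[of w]
      unfolding norm_minus_cancel power2_eq_square by (simp only: algebra_simps)
    show "(Li2 has_field_derivative - Ln (1 - z) / z) (at z)" if "z \<noteq> 0" "cmod z < 1" for z
      by (rule has_field_derivative_Li2_complex[OF that(2,1)])
  qed (auto intro!: continuous_intros simp: Li2_of_real)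
  then have h1: "((\<lambda>t. - lsin (t / 2)) has_integral Im (Li2 (cis \<sigma>))) {0..\<sigma>}" by simp
  have h2: "((\<lambda>t. - lsin (t / 2)) has_integral - (2 * (lsin_int (\<sigma> / 2) - lsin_int (0 / 2)))) {0..\<sigma>}"
    using \<sigma> by (intro has_integral_neg has_integral_half[of lsin] has_integral_lsin) auto
  have "Im (Li2 (cis \<sigma>)) = (\<Sum>n. Im (cis \<sigma> ^ Suc n / of_nat (Suc n) ^ 2))"
    unfolding Li2_def by (intro Im_suminf summable_Li2) auto
  also have "\<dots> = Cl2 \<sigma>"
    unfolding Cl2_def
  proof (rule suminf_cong)
    fix n
    show "Im (cis \<sigma> ^ Suc n / of_nat (Suc n) ^ 2) = sin (real (Suc n) * \<sigma>) / (real (Suc n))\<^sup>2"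
      unfolding Complex.DeMoivre by (simp flip: of_nat_power del: of_nat_Suc)
  qed
  finally show ?thesis using has_integral_unique[OF h1 h2] by simp
qed

section \<open>The inverse tangent integral\<close>

text \<open>The product \<open>x * ti_series k (x\<^sup>2)\<close> is the inverse tangent integral
  Ti_k(x), which is \<open>arctan x\<close> for \<open>k = 1\<close>; the variable
  \<open>y = x\<^sup>2\<close> makes it an ordinary power series.\<close>

definition ti_series :: "nat \<Rightarrow> real \<Rightarrow> real" where
  "ti_series k y = (\<Sum>n. (-1) ^ n / real (2 * n + 1) ^ k * y ^ n)"

lemma ti_series_coeff_le: "\<bar>(-1) ^ n / real (2 * n + 1) ^ k * y ^ n\<bar> \<le> \<bar>y\<bar> ^ n"
proof -
  have "1 \<le> real (2 * n + 1) ^ k" by (rule one_le_power) simp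
  then show ?thesis
    by (simp add: abs_mult power_abs divide_le_eq mult_le_cancel_left1)
qed

lemma summable_ti_series: "\<bar>y\<bar> < 1 \<Longrightarrow> summable (\<lambda>n. (-1) ^ n / real (2 * n + 1) ^ k * y ^ n)"
  by (rule summable_comparison_test'[of "\<lambda>n. \<bar>y\<bar> ^ n" 0]) (use ti_series_coeff_le in \<open>auto simp del: of_nat_add of_nat_mult\<close>)

lemma ti_series_0 [simp]: "ti_series k 0 = 1"
proof -
  have "(\<lambda>n. (-1) ^ n / real (2 * n + 1) ^ k * 0 ^ n) = (\<lambda>n. if n = 0 then 1 else 0 :: real)"
    by auto
  then show ?thesis unfolding ti_series_def using suminf_finite[of "{0}" "\<lambda>n. if n = 0 then 1 else 0 :: real"] by simp
qed

text \<open>The operator 1 + 2 y d/dy multiplies the n-th coefficient by \<open>2 * n + 1\<close>,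
  lowering the exponent from \<open>Suc k\<close> to k. The derivative enters later only through
  this relation.\<close>

lemma has_real_derivative_ti_series:
  assumes y: "\<bar>y\<bar> < 1"
  obtains d where "(ti_series (Suc k) has_real_derivative d) (at y)" "ti_series (Suc k) y + 2 * y * d = ti_series k y"
proof -
  define c where "c n = (-1) ^ n / real (2 * n + 1) ^ Suc k" for n
  obtain K where K: "\<bar>y\<bar> < K" "K < 1" using y dense by blast
  have "summable (\<lambda>n. c n * K ^ n)" using summable_ti_series[of K "Suc k"] K by (simp add: c_def)
  note td = termdiffs_strong[OF this, of y]
  have 1: "(ti_series (Suc k) has_real_derivative (\<Sum>n. diffs c n * y ^ n)) (at y)"
  proof -
    have "ti_series (Suc k) = (\<lambda>x. \<Sum>n. c n * x ^ n)" by (simp only: ti_series_def[abs_def] c_def)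
    with td K show ?thesis by simp
  qed
  have s0: "summable (\<lambda>n. c n * y ^ n)" using summable_ti_series[OF y, of "Suc k"] by (simp add: c_def)
  have cc: "c n + 2 * (real n * c n) = (-1) ^ n / real (2 * n + 1) ^ k" for n
  proof -
    have "c n + 2 * (real n * c n) = real (2 * n + 1) * c n" by (simp add: algebra_simps)
    then show ?thesis by (simp add: c_def del: of_nat_add of_nat_mult)
  qed
  \<comment> \<open>The coefficient relation exhibits twice the terms \<open>n c_n y^n\<close> as a
    difference of two summable sequences.\<close>
  have "summable (\<lambda>n. (-1) ^ n / real (2 * n + 1) ^ k * y ^ n - c n * y ^ n)"
    by (intro summable_diff summable_ti_series y s0)
  also have "(\<lambda>n. (-1) ^ n / real (2 * n + 1) ^ k * y ^ n - c n * y ^ n) = (\<lambda>n. 2 * (real n * c n * y ^ n))"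
    unfolding cc[symmetric] by (simp add: fun_eq_iff algebra_simps)
  finally have s1: "summable (\<lambda>n. real n * c n * y ^ n)"
    using summable_mult_D[of 2] by fastforce
  have "y * (\<Sum>n. diffs c n * y ^ n) = (\<Sum>n. real n * c n * y ^ n)"
  proof (cases "y = 0")
    case True
    have "(\<lambda>n. real n * c n * y ^ n) = (\<lambda>n. 0)" using True by (auto simp: fun_eq_iff)
    then show ?thesis using True by simp
  next
    case False
    have "summable (\<lambda>n. real (Suc n) * c (Suc n) * y ^ Suc n)"
      using s1 by (subst summable_Suc_iff)
    from summable_mult[OF this, of "inverse y"] False
    have "summable (\<lambda>n. diffs c n * y ^ n)" by (simp add: diffs_def mult_ac)
    from suminf_mult[OF this, of y]
    have "y * (\<Sum>n. diffs c n * y ^ n) = (\<Sum>n. real (Suc n) * c (Suc n) * y ^ Suc n)"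
      by (simp add: diffs_def mult_ac)
    then show ?thesis using suminf_split_head[OF s1] by simp
  qed
  then have "ti_series (Suc k) y + 2 * y * (\<Sum>n. diffs c n * y ^ n) = (\<Sum>n. c n * y ^ n) + 2 * (\<Sum>n. real n * c n * y ^ n)"
    by (simp add: ti_series_def c_def)
  also have "\<dots> = (\<Sum>n. c n * y ^ n + 2 * (real n * c n * y ^ n))"
    using s0 s1 by (simp add: suminf_add suminf_mult[symmetric] summable_mult)
  also have "(\<lambda>n. c n * y ^ n + 2 * (real n * c n * y ^ n)) = (\<lambda>n. (-1) ^ n / real (2 * n + 1) ^ k * y ^ n)"
    unfolding cc[symmetric] by (simp add: fun_eq_iff algebra_simps)
  finally show ?thesis using 1 that by (simp add: ti_series_def)
qed

lemma isCont_ti_series: "\<bar>y\<bar> < 1 \<Longrightarrow> isCont (ti_series (Suc k)) y"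
  by (metis DERIV_isCont has_real_derivative_ti_series)

text \<open>This is the rule Ti_(k+1)'(x) = Ti_k(x) / x; the product rule and the inner derivative
  \<open>2 * x\<close> assemble the operator of
  \<open>has_real_derivative_ti_series\<close>.\<close>

lemma has_real_derivative_inverse_tangent_integral:
  assumes "\<bar>x\<bar> < 1" "x \<noteq> 0"
  shows "((\<lambda>x. x * ti_series (Suc k) (x\<^sup>2)) has_real_derivative ti_series k (x\<^sup>2)) (at x)"
proof -
  have "\<bar>x\<^sup>2\<bar> < 1" using assms by (simp add: abs_square_less_1)
  from has_real_derivative_ti_series[OF this] obtain d where
    d: "(ti_series (Suc k) has_real_derivative d) (at (x\<^sup>2))" "ti_series (Suc k) (x\<^sup>2) + 2 * x\<^sup>2 * d = ti_series k (x\<^sup>2)"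
    by metis
  have "((\<lambda>x. x\<^sup>2) has_real_derivative 2 * x) (at x)" by (auto intro!: derivative_eq_intros)
  from DERIV_chain2[OF d(1) this]
  have "((\<lambda>x. ti_series (Suc k) (x\<^sup>2)) has_real_derivative d * (2 * x)) (at x)" .
  then have "((\<lambda>x. x * ti_series (Suc k) (x\<^sup>2)) has_real_derivative ti_series (Suc k) (x\<^sup>2) + 2 * x\<^sup>2 * d) (at x)"
    by (auto intro!: derivative_eq_intros simp: power2_eq_square algebra_simps)
  then show ?thesis by (simp only: d(2))
qed

lemma arctan_eq_ti_series: "\<bar>x\<bar> < 1 \<Longrightarrow> arctan x = x * ti_series 1 (x\<^sup>2)"
proof -
  assume x: "\<bar>x\<bar> < 1"
  then have "\<bar>x\<^sup>2\<bar> < 1" by (simp add: abs_square_less_1)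
  from suminf_mult[OF summable_ti_series[OF this, of 1], of x]
  have "x * ti_series 1 (x\<^sup>2) = (\<Sum>n. x * ((-1) ^ n / real (2 * n + 1) * (x\<^sup>2) ^ n))" by (simp add: ti_series_def)
  also have "(\<lambda>n. x * ((-1) ^ n / real (2 * n + 1) * (x\<^sup>2) ^ n)) = (\<lambda>n. (-1) ^ n * (1 / real (n * 2 + 1) * x ^ (n * 2 + 1)))"
    by (simp add: fun_eq_iff power_mult[of x 2] mult.commute[of _ 2])
  finally show ?thesis using x by (simp add: arctan_series)
qed

lemma Ti3_eq_ti_series: "\<bar>x\<bar> < 1 \<Longrightarrow> Ti3 x = x * ti_series 3 (x\<^sup>2)"
proof -
  assume x: "\<bar>x\<bar> < 1"
  then have "\<bar>x\<^sup>2\<bar> < 1" by (simp add: abs_square_less_1)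
  from suminf_mult[OF summable_ti_series[OF this, of 3], of x]
  have "x * ti_series 3 (x\<^sup>2) = (\<Sum>n. x * ((-1) ^ n / real (2 * n + 1) ^ 3 * (x\<^sup>2) ^ n))" by (simp add: ti_series_def)
  also have "(\<lambda>n. x * ((-1) ^ n / real (2 * n + 1) ^ 3 * (x\<^sup>2) ^ n)) = (\<lambda>n. (-1) ^ n * x ^ (2 * n + 1) / real (2 * n + 1) ^ 3)"
    by (simp add: fun_eq_iff power_mult[of x 2])
  finally show ?thesis by (simp add: Ti3_def)
qed

text \<open>Repeated integration by parts. With \<open>l = ln (tan p) + ln 3 / 2\<close>, the
  antiderivative is l^2 p / 2 - l Ti_2(tan p) + Ti_3(tan p). The shift \<open>ln 3 / 2\<close> makes
  l vanish at \<open>pi / 6\<close>, so only Ti_3 remains there.\<close>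

lemma has_integral_Ti3:
  "((\<lambda>p. (ln (tan p) + ln 3 / 2)\<^sup>2 / 2) has_integral Ti3 (1 / sqrt 3)) {0..pi / 6}"
proof -
  let ?c = "ln 3 / 2 :: real"
  let ?W = "\<lambda>p. (ln (tan p) + ?c)\<^sup>2 * p / 2 - (ln (tan p) + ?c) * (tan p * ti_series 2 ((tan p)\<^sup>2))
     + tan p * ti_series 3 ((tan p)\<^sup>2)"
  have tan: "0 < tan p" "tan p < 1" "0 < cos p" "arctan (tan p) = p" if "0 < p" "p \<le> pi / 6" for p
  proof -
    have "p < pi / 4" using that pi_gt_zero by linarith
    then show "tan p < 1" using tan_monotone[of p "pi/4"] that by (simp add: tan_45)
    show "0 < tan p" "0 < cos p" using that by (auto intro!: tan_gt_zero cos_gt_zero)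
    show "arctan (tan p) = p" using that \<open>p < pi / 4\<close> by (intro arctan_tan) linarith+
  qed
  have D: "(?W has_real_derivative (ln (tan p) + ?c)\<^sup>2 / 2) (at p)" if p: "0 < p" "p \<le> pi / 6" for p
  proof -
    note t = tan[OF p]
    have "\<bar>tan p\<bar> < 1" "tan p \<noteq> 0" "cos p \<noteq> 0" using t by auto
    have T: "(tan has_real_derivative inverse ((cos p)\<^sup>2)) (at p)"
      using t by (intro DERIV_tan) auto
    note D1 = has_real_derivative_inverse_tangent_integral[OF \<open>\<bar>tan p\<bar> < 1\<close> \<open>tan p \<noteq> 0\<close>]
    have D3: "((\<lambda>p. tan p * ti_series 3 ((tan p)\<^sup>2)) has_real_derivative ti_series 2 ((tan p)\<^sup>2) * inverse ((cos p)\<^sup>2)) (at p)"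
      using DERIV_chain2[OF D1[of 2] T] by (simp add: numeral_3_eq_3 numeral_2_eq_2)
    have D2: "((\<lambda>p. tan p * ti_series 2 ((tan p)\<^sup>2)) has_real_derivative ti_series 1 ((tan p)\<^sup>2) * inverse ((cos p)\<^sup>2)) (at p)"
      using DERIV_chain2[OF D1[of 1] T] by (simp add: numeral_2_eq_2)
    have "p = tan p * ti_series 1 ((tan p)\<^sup>2)" using arctan_eq_ti_series[OF \<open>\<bar>tan p\<bar> < 1\<close>] t by simp
    then have T1: "ti_series 1 ((tan p)\<^sup>2) = p / tan p" using t by (simp add: field_simps)
    have L: "((\<lambda>p. ln (tan p) + ?c) has_real_derivative inverse ((cos p)\<^sup>2) / tan p) (at p)"
      using t T by (auto intro!: derivative_eq_intros)
    have "(?W has_real_derivative ((ln (tan p) + ?c)\<^sup>2 + 2 * (ln (tan p) + ?c) * (inverse ((cos p)\<^sup>2) / tan p) * p) / 2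
       - ((inverse ((cos p)\<^sup>2) / tan p) * (tan p * ti_series 2 ((tan p)\<^sup>2)) + (ln (tan p) + ?c) * (ti_series 1 ((tan p)\<^sup>2) * inverse ((cos p)\<^sup>2)))
       + ti_series 2 ((tan p)\<^sup>2) * inverse ((cos p)\<^sup>2)) (at p)"
      by (rule derivative_eq_intros L D2 D3 refl | simp)+
    moreover have "(l\<^sup>2 + 2 * l * (s / u) * p) / 2 - ((s / u) * (u * T) + l * (p / u * s)) + T * s = l\<^sup>2 / 2"
      if "u \<noteq> 0" for l s u T :: real using that by (simp add: field_simps)
    ultimately show ?thesis unfolding T1 using \<open>tan p \<noteq> 0\<close> by (simp only: not_False_eq_True)
  qed
  have "continuous_on {0..pi / 6} ?W"
  proof (rule continuous_on_Icc_zeroI)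
    show "isCont ?W p" if "0 < p" "p \<le> pi / 6" for p using D[OF that] by (rule DERIV_isCont)
    \<comment> \<open>The logarithms occur only multiplied by p or \<open>tan p\<close> and so tend
      to 0; the series factors have finite limits.\<close>
    have "((\<lambda>p::real. (tan p)\<^sup>2) \<longlongrightarrow> 0) (at_right 0)" by real_asymp
    then have ti_series: "((\<lambda>p. ti_series (Suc k) ((tan p)\<^sup>2)) \<longlongrightarrow> ti_series (Suc k) 0) (at_right 0)" for k
      by (intro isCont_tendsto_compose[OF isCont_ti_series]) auto
    have "((\<lambda>p::real. (ln (tan p) + ?c)\<^sup>2 * p / 2) \<longlongrightarrow> 0) (at_right 0)" by real_asymp
    moreover have "((\<lambda>p::real. (ln (tan p) + ?c) * tan p) \<longlongrightarrow> 0) (at_right 0)" by real_asymp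
    moreover have "((\<lambda>p::real. tan p) \<longlongrightarrow> 0) (at_right 0)" by real_asymp
    ultimately have "((\<lambda>p. (ln (tan p) + ?c)\<^sup>2 * p / 2 - (ln (tan p) + ?c) * tan p * ti_series (Suc 1) ((tan p)\<^sup>2)
       + tan p * ti_series (Suc 2) ((tan p)\<^sup>2)) \<longlongrightarrow> 0 - 0 * ti_series (Suc 1) 0 + 0 * ti_series (Suc 2) 0) (at_right 0)"
      by (intro tendsto_intros ti_series)
    then show "(?W \<longlongrightarrow> ?W 0) (at_right 0)" by (simp add: mult.assoc numeral_2_eq_2 numeral_3_eq_3)
  qed
  then have "((\<lambda>p. (ln (tan p) + ?c)\<^sup>2 / 2) has_integral (?W (pi / 6) - ?W 0)) {0..pi / 6}"
    using D by (intro fundamental_theorem_of_calculus_interior)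
      (auto simp flip: has_real_derivative_iff_has_vector_derivative)
  moreover have "?W 0 = 0" by simp
  moreover have "?W (pi / 6) = Ti3 (1 / sqrt 3)"
  proof -
    have "1 < sqrt (3::real)" by (rule real_less_rsqrt) simp
    then have "\<bar>1 / sqrt (3::real)\<bar> < 1" by simp
    moreover have "ln (1 / sqrt 3) + ?c = 0" by (simp add: ln_div ln_sqrt)
    ultimately show ?thesis by (simp only: tan_30 Ti3_eq_ti_series) simp
  qed
  ultimately show ?thesis by simp
qed

text \<open>With \<open>a = lsin t\<close> and \<open>b = lsin (pi / 2 - t)\<close>,
  \<open>(a - b)^2 / 2 = a^2 + b^2 - (a + b)^2 / 2\<close> and \<open>a + b = lsin (2 * t)\<close>.
  The coefficient -5/4 of S(pi/3) is -1 from \<open>b^2\<close> and -1/4 from the doubled argument;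
  the factor 5/6 uses A(pi/3) = 2/3 A(pi/6).\<close>

lemma Ti3_eq:
  "Ti3 (1 / sqrt 3) = lsin_sq_int (pi / 6) + lsin_sq_int (pi / 2) - 5 / 4 * lsin_sq_int (pi / 3) + 5 / 6 * ln 3 * lsin_int (pi / 6) + pi * (ln 3)\<^sup>2 / 48"
proof -
  let ?b = "\<lambda>t. pi / 2 - t"
  have a2: "((\<lambda>t. (lsin t)\<^sup>2) has_integral lsin_sq_int (pi / 6) - lsin_sq_int 0) {0..pi / 6}"
    by (intro has_integral_lsin_squared) auto
  have b2: "((\<lambda>t. (lsin (?b t))\<^sup>2) has_integral lsin_sq_int (pi / 2) - lsin_sq_int (pi / 3)) {0..pi / 6}"
    using has_integral_reflect_at[OF has_integral_lsin_squared[of "pi / 3" "pi / 2"], of "pi / 2"] by simp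
  have c2: "((\<lambda>t. (lsin (2 * t))\<^sup>2) has_integral (lsin_sq_int (2 * (pi / 6)) - lsin_sq_int (2 * 0)) / 2) {0..pi / 6}"
    by (intro has_integral_scale2[of "\<lambda>t. (lsin t)\<^sup>2"] has_integral_lsin_squared) auto
  have a1: "(lsin has_integral lsin_int (pi / 6) - lsin_int 0) {0..pi / 6}"
    by (intro has_integral_lsin) auto
  have b1: "((\<lambda>t. lsin (?b t)) has_integral lsin_int (pi / 2) - lsin_int (pi / 3)) {0..pi / 6}"
    using has_integral_reflect_at[OF has_integral_lsin[of "pi / 3" "pi / 2"], of "pi / 2"] by simp
  have k: "((\<lambda>t. (ln 3)\<^sup>2 / 8) has_integral pi / 6 * ((ln 3)\<^sup>2 / 8)) {0..pi / 6}"
    using has_integral_const_real[of "(ln 3)\<^sup>2 / 8 :: real" 0 "pi / 6"] by simp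
  let ?I = "(lsin_sq_int (pi / 6) - lsin_sq_int 0) + (lsin_sq_int (pi / 2) - lsin_sq_int (pi / 3)) - (lsin_sq_int (2 * (pi / 6)) - lsin_sq_int (2 * 0)) / 2 * (1 / 2)
        + ((lsin_int (pi / 6) - lsin_int 0) - (lsin_int (pi / 2) - lsin_int (pi / 3))) * (ln 3 / 2) + pi / 6 * ((ln 3)\<^sup>2 / 8)"
  have "((\<lambda>t. (lsin t)\<^sup>2 + (lsin (?b t))\<^sup>2 - (lsin (2 * t))\<^sup>2 * (1 / 2) + (lsin t - lsin (?b t)) * (ln 3 / 2) + (ln 3)\<^sup>2 / 8)
      has_integral ?I) {0..pi / 6}"
    by (intro has_integral_add has_integral_diff has_integral_mult_left a1 a2 b1 b2 c2 k)
  then have h1: "((\<lambda>p. (ln (tan p) + ln 3 / 2)\<^sup>2 / 2) has_integral ?I) {0..pi / 6}"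
  proof (rule has_integral_spike_finite[where S = "{0}", rotated 2])
    fix t assume "t \<in> {0..pi / 6} - {0}"
    then have t: "0 < t" "t < pi / 2" using pi_gt_zero by (auto simp only: Diff_iff atLeastAtMost_iff insert_iff)
    have "0 < sin t" "0 < cos t" using t by (auto intro!: sin_gt_zero cos_gt_zero)
    moreover have "tan t = (2 * sin t) / (2 * cos t)" by (simp add: tan_def)
    ultimately have "ln (tan t) = lsin t - lsin (?b t)"
      by (simp only: lsin_def ln_div) (simp add: ln_div sin_diff)
    moreover have "lsin (2 * t) = lsin t + lsin (?b t)" using t by (rule lsin_double)
    moreover have "(a - b + c / 2)\<^sup>2 / 2 = a\<^sup>2 + b\<^sup>2 - (a + b)\<^sup>2 * (1 / 2) + (a - b) * (c / 2) + c\<^sup>2 / 8"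
      for a b c :: real by (simp add: power2_eq_square field_simps)
    ultimately show "(ln (tan t) + ln 3 / 2)\<^sup>2 / 2 = (lsin t)\<^sup>2 + (lsin (?b t))\<^sup>2 - (lsin (2 * t))\<^sup>2 * (1 / 2)
        + (lsin t - lsin (?b t)) * (ln 3 / 2) + (ln 3)\<^sup>2 / 8"
      by (simp only:)
  qed auto
  have "Ti3 (1 / sqrt 3) = ?I" by (rule has_integral_unique[OF has_integral_Ti3 h1])
  then show ?thesis by (simp add: lsin_int_pi_third field_simps)
qed

text \<open>The factor 24 / (5 pi) turns -5/4 S(pi/3) into -6/pi S(pi/3). The terms in A(pi/6)
  cancel against \<open>Cl2\<close>, those in \<open>(ln 3)^2\<close> cancel as well, and the
  multiples of \<open>pi^2\<close> add up to 16/45 - 19/180 = 1/4.\<close>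

lemma Ti3_Cl2_eq:
  "24 / (5 * pi) * Ti3 (1 / sqrt 3) + 2 * ln 3 / pi * Cl2 (pi / 3) - (ln 3) ^ 2 / 10 - 19 * pi ^ 2 / 180
   = pi ^ 2 / 4 - 6 / pi * lsin_sq_int (pi / 3)"
proof -
  have C: "Cl2 (pi / 3) = - 2 * lsin_int (pi / 6)" using Cl2_eq_lsin_int[of "pi / 3"] by simp
  show ?thesis unfolding Ti3_eq C lsin_sq_int_pi_sixth lsin_sq_int_pi_half
    by (simp add: field_simps power2_eq_square power3_eq_cube)
qed

section \<open>The mean of the squared logarithm over a circle\<close>

text \<open>Termwise integration: the M-test gives uniform convergence on the interval, and
  uniqueness of integrals and sums identifies the values.\<close>

lemma has_integral_sums:
  fixes f :: "nat \<Rightarrow> real \<Rightarrow> real"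
  assumes I: "\<And>n. (f n has_integral I n) {a..b}"
    and cont: "\<And>n. continuous_on {a..b} (f n)"
    and M: "\<And>n x. x \<in> {a..b} \<Longrightarrow> \<bar>f n x\<bar> \<le> M n" "summable M"
    and sums: "\<And>x. x \<in> {a..b} \<Longrightarrow> (\<lambda>n. f n x) sums g x"
    and J: "I sums J"
  shows "(g has_integral J) {a..b}"
proof -
  have "uniform_limit {a..b} (\<lambda>n x. \<Sum>i<n. f i x) (\<lambda>x. \<Sum>i. f i x) sequentially"
    using M by (intro Weierstrass_m_test) auto
  then have u: "uniform_limit {a..b} (\<lambda>n x. \<Sum>i<n. f i x) g sequentially"
    by (rule uniform_limit_cong'[THEN iffD1, rotated -1]) (use sums in \<open>auto simp: sums_iff\<close>)
  have c: "continuous_on {a..b} (\<lambda>x. \<Sum>i<n. f i x)" for n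
    by (intro continuous_intros cont)
  obtain I' J' where *: "\<And>n. ((\<lambda>x. \<Sum>i<n. f i x) has_integral I' n) {a..b}"
    "(g has_integral J') {a..b}" "I' \<longlonglongrightarrow> J'"
    using uniform_limit_integral[OF u c sequentially_bot] by blast
  have "((\<lambda>x. \<Sum>i<n. f i x) has_integral (\<Sum>i<n. I i)) {a..b}" for n
    by (intro has_integral_sum I) auto
  then have "I' = (\<lambda>n. \<Sum>i<n. I i)"
    by (intro ext has_integral_unique[OF *(1)])
  then have "I sums J'" using *(3) by (simp only: sums_def)
  then have "J' = J" using J sums_unique2 by blast
  with *(2) show ?thesis by simp
qed

section \<open>Fourier expansion of the logarithm on a circle\<close>

lemma has_integral_Re_cis:
  fixes k :: int
  shows "((\<lambda>s. Re (z * cis (2 * pi * of_int k * s))) has_integral (if k = 0 then Re z else 0)) {0..1}"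
proof (cases "k = 0")
  case True
  have "((\<lambda>s::real. Re z) has_integral Re z) {0..1}"
    by (rule has_integral_eq_rhs[OF has_integral_const_real]) simp
  then show ?thesis by (simp only: True of_int_0 mult_zero_right mult_zero_left cis_zero mult_1_right if_True refl)
next
  case False
  define c where "c = 2 * pi * of_int k"
  let ?F = "\<lambda>s. (Re z * sin (c * s) + Im z * cos (c * s)) / c"
  have c: "c \<noteq> 0" "sin c = 0" "cos c = 1"
    using False sin_int_2pin[of k] cos_int_2pin[of k] by (auto simp: c_def)
  have "((\<lambda>s. Re z * cos (c * s) - Im z * sin (c * s)) has_integral (?F 1 - ?F 0)) {0..1}"
    unfolding has_real_derivative_iff_has_vector_derivative[symmetric]
    by (intro fundamental_theorem_of_calculus)
      (use c(1) in \<open>auto intro!: derivative_eq_intros simp: field_simps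
        simp flip: has_real_derivative_iff_has_vector_derivative\<close>)
  moreover have "?F 1 - ?F 0 = 0" using c by simp
  ultimately show ?thesis using False by (simp add: c_def)
qed

definition harmonic :: "complex \<Rightarrow> nat \<Rightarrow> real \<Rightarrow> real" where
  "harmonic w n s = Re (w ^ Suc n * cis (2 * pi * real (Suc n) * s))"

lemma harmonic_le: "\<bar>harmonic w n s\<bar> \<le> cmod w ^ Suc n"
  unfolding harmonic_def using abs_Re_le_cmod[of "w ^ Suc n * cis (2 * pi * real (Suc n) * s)"]
  by (simp add: norm_mult norm_power)

lemma continuous_on_harmonic: "continuous_on A (harmonic w n)"
  unfolding harmonic_def by (intro continuous_intros)

lemma has_integral_harmonic: "(harmonic w n has_integral 0) {0..1}"
  using has_integral_Re_cis[of "w ^ Suc n" "int (Suc n)"] by (simp add: harmonic_def[abs_def] del: of_nat_Suc)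

text \<open>Orthogonality, from \<open>Re a * Re b = (Re (a * b) + Re (a * cnj b)) / 2\<close>: the
  sum of the frequencies is never 0, their difference only for \<open>n = m\<close>. The frequencies
  are integers because the difference may be negative.\<close>

lemma has_integral_harmonic_mult:
  "((\<lambda>s. harmonic w n s * harmonic w m s) has_integral (if n = m then (cmod w ^ Suc n)\<^sup>2 / 2 else 0)) {0..1}"
proof -
  let ?k = "int (Suc n) + int (Suc m)" and ?l = "int (Suc n) - int (Suc m)"
  let ?z = "w ^ Suc n * w ^ Suc m" and ?z' = "w ^ Suc n * cnj (w ^ Suc m)"
  have eq: "harmonic w n s * harmonic w m s =
      (Re (?z * cis (2 * pi * of_int ?k * s)) + Re (?z' * cis (2 * pi * of_int ?l * s))) / 2" for s
  proof -
    let ?a = "w ^ Suc n * cis (2 * pi * real (Suc n) * s)"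
    let ?b = "w ^ Suc m * cis (2 * pi * real (Suc m) * s)"
    have "harmonic w n s * harmonic w m s = (Re (?a * ?b) + Re (?a * cnj ?b)) / 2"
    proof -
      have "Re a * Re b = (Re (a * b) + Re (a * cnj b)) / 2" for a b by simp
      then show ?thesis unfolding harmonic_def .
    qed
    also have "?a * ?b = ?z * cis (2 * pi * of_int ?k * s)"
      by (simp add: cis_mult algebra_simps del: of_nat_Suc power_Suc)
    also have "?a * cnj ?b = ?z' * (cis (2 * pi * real (Suc n) * s) * cis (- (2 * pi * real (Suc m) * s)))"
      by (simp add: cis_cnj mult_ac del: of_nat_Suc power_Suc)
    also have "cis (2 * pi * real (Suc n) * s) * cis (- (2 * pi * real (Suc m) * s)) = cis (2 * pi * of_int ?l * s)"
      unfolding cis_mult by (rule arg_cong[where f = cis]) (simp add: algebra_simps)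
    finally show ?thesis .
  qed
  have "((\<lambda>s. (Re (?z * cis (2 * pi * of_int ?k * s)) + Re (?z' * cis (2 * pi * of_int ?l * s))) / 2)
      has_integral ((if ?k = 0 then Re ?z else 0) + (if ?l = 0 then Re ?z' else 0)) / 2) {0..1}"
    by (intro has_integral_divide has_integral_add has_integral_Re_cis)
  moreover have "((if ?k = 0 then Re ?z else 0) + (if ?l = 0 then Re ?z' else 0)) / 2
      = (if n = m then (cmod w ^ Suc n)\<^sup>2 / 2 else 0)"
  proof (cases "n = m")
    case True
    have "w ^ Suc n * cnj (w ^ Suc n) = of_real ((cmod (w ^ Suc n))\<^sup>2)"
      by (rule complex_norm_square[symmetric])
    then have "Re ?z' = (cmod w ^ Suc n)\<^sup>2"
      by (simp only: True norm_power Re_complex_of_real)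
    then show ?thesis using True by simp
  qed simp
  ultimately show ?thesis unfolding eq by simp
qed

definition ln_circle :: "complex \<Rightarrow> real \<Rightarrow> real" where
  "ln_circle w s = ln (cmod (1 + w * cis (2 * pi * s)))"

lemma ln_circle_sums:
  assumes "cmod w < 1"
  shows "(\<lambda>n. (-1) ^ n / real (Suc n) * harmonic w n s) sums ln_circle w s"
proof -
  let ?z = "w * cis (2 * pi * s)"
  have z: "cmod ?z < 1" using assms by (simp add: norm_mult)
  then have "1 + ?z \<noteq> 0" by (metis add_eq_0_iff norm_minus_cancel norm_one less_irrefl)
  have "(\<lambda>n. - ((- ?z) ^ n) / of_nat n) sums Ln (1 + ?z)"
    by (rule Ln_series'[OF z])
  then have "(\<lambda>n. - ((- ?z) ^ Suc n) / of_nat (Suc n)) sums Ln (1 + ?z)"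
    by (subst sums_Suc_iff) simp
  from sums_Re[OF this] have "(\<lambda>n. Re (- ((- ?z) ^ Suc n) / of_nat (Suc n))) sums ln_circle w s"
    using Re_Ln[OF \<open>1 + ?z \<noteq> 0\<close>] by (simp add: ln_circle_def)
  moreover have "Re (- ((- ?z) ^ Suc n) / of_nat (Suc n)) = (-1) ^ n / real (Suc n) * harmonic w n s" for n
  proof -
    have "- ((- ?z) ^ Suc n) = of_real ((-1) ^ n) * ?z ^ Suc n"
      by (subst power_minus) simp
    also have "?z ^ Suc n = w ^ Suc n * cis (2 * pi * real (Suc n) * s)"
      unfolding power_mult_distrib Complex.DeMoivre by (simp only: mult_ac)
    finally have "- ((- ?z) ^ Suc n) / of_nat (Suc n) =
      of_real ((-1) ^ n / real (Suc n)) * (w ^ Suc n * cis (2 * pi * real (Suc n) * s))"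
      by (simp del: of_nat_Suc power_Suc)
    then show ?thesis unfolding harmonic_def by (simp only: Re_complex_of_real Im_complex_of_real times_complex.sel)
  qed
  ultimately show ?thesis by (simp only:)
qed

lemma norm_sign_harmonic_le: "\<bar>(-1) ^ n / real (Suc n) * harmonic w n s\<bar> \<le> cmod w ^ Suc n"
proof -
  have "\<bar>(-1) ^ n / real (Suc n) * harmonic w n s\<bar> = 1 / real (Suc n) * \<bar>harmonic w n s\<bar>"
    by (simp add: abs_mult power_abs)
  also have "\<dots> \<le> 1 * cmod w ^ Suc n" by (intro mult_mono harmonic_le) auto
  finally show ?thesis by simp
qed

lemma summable_Suc_power: "0 \<le> r \<Longrightarrow> r < 1 \<Longrightarrow> summable (\<lambda>n. r ^ Suc n)" for r :: real
  using summable_geometric[of r] by (subst summable_Suc_iff) simp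

text \<open>Parseval by two termwise integrations: one against a fixed harmonic yields its Fourier
  coefficient, the other against \<open>ln_circle w\<close> itself sums the squares to half a
  dilogarithm.\<close>

lemma has_integral_ln_circle_squared:
  assumes w: "cmod w < 1"
  shows "((\<lambda>s. (ln_circle w s)\<^sup>2) has_integral Li2 ((cmod w)\<^sup>2) / 2) {0..1}"
proof -
  let ?c = "\<lambda>n. (-1) ^ n / real (Suc n)"
  have sM: "summable (\<lambda>n. cmod w ^ Suc n)" using w by (intro summable_Suc_power) auto
  have 1: "((\<lambda>s. ln_circle w s * harmonic w m s) has_integral ?c m * ((cmod w ^ Suc m)\<^sup>2 / 2)) {0..1}" for m
  proof (rule has_integral_sums)
    show "((\<lambda>s. ?c n * harmonic w n s * harmonic w m s) has_integral
        (if n = m then ?c m * ((cmod w ^ Suc m)\<^sup>2 / 2) else 0)) {0..1}" for n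
      using has_integral_mult_right[OF has_integral_harmonic_mult[of w n m], of "?c n"] by (simp add: mult.assoc if_distrib cong: if_cong)
    show "\<bar>?c n * harmonic w n s * harmonic w m s\<bar> \<le> cmod w ^ Suc n * cmod w ^ Suc m" for n s
      unfolding abs_mult[of _ "harmonic w m s"] by (intro mult_mono norm_sign_harmonic_le harmonic_le) auto
    show "(\<lambda>n. ?c n * harmonic w n s * harmonic w m s) sums (ln_circle w s * harmonic w m s)" for s
      by (intro sums_mult2 ln_circle_sums w)
    show "(\<lambda>n. if n = m then ?c m * ((cmod w ^ Suc m)\<^sup>2 / 2) else 0) sums (?c m * ((cmod w ^ Suc m)\<^sup>2 / 2))"
      by (rule sums_single)
  qed (intro continuous_intros continuous_on_harmonic summable_mult2 sM)+
  \<comment> \<open>A bound uniform in s, which supplies the majorant of the second termwise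
    integration.\<close>
  have bound: "\<bar>ln_circle w s\<bar> \<le> (\<Sum>n. cmod w ^ Suc n)" for s
  proof -
    have s: "summable (\<lambda>n. \<bar>?c n * harmonic w n s\<bar>)"
      by (rule summable_comparison_test'[OF sM, of 0]) (simp only: real_norm_def abs_idempotent norm_sign_harmonic_le)
    have "\<bar>ln_circle w s\<bar> \<le> (\<Sum>n. \<bar>?c n * harmonic w n s\<bar>)"
      using summable_rabs[OF s] ln_circle_sums[OF w, of s] by (simp only: sums_iff)
    also have "\<dots> \<le> (\<Sum>n. cmod w ^ Suc n)" by (intro suminf_le norm_sign_harmonic_le s sM)
    finally show ?thesis .
  qed
  have "1 + w * cis (2 * pi * s) \<noteq> 0" for s
  proof
    assume "1 + w * cis (2 * pi * s) = 0"
    then have "w * cis (2 * pi * s) = - 1" by (simp add: add_eq_0_iff)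
    then have "cmod (w * cis (2 * pi * s)) = 1" by simp
    with w show False by (simp add: norm_mult)
  qed
  then have cont: "continuous_on {0..1} (ln_circle w)"
    unfolding ln_circle_def by (intro continuous_intros) auto
  have "((\<lambda>s. ln_circle w s * ln_circle w s) has_integral Li2 ((cmod w)\<^sup>2) / 2) {0..1}"
  proof (rule has_integral_sums)
    show "((\<lambda>s. ln_circle w s * (?c m * harmonic w m s)) has_integral ?c m * (?c m * ((cmod w ^ Suc m)\<^sup>2 / 2))) {0..1}" for m
      using has_integral_mult_right[OF 1[of m], of "?c m"] by (simp only: mult_ac)
    show "\<bar>ln_circle w s * (?c m * harmonic w m s)\<bar> \<le> (\<Sum>n. cmod w ^ Suc n) * cmod w ^ Suc m" for m s
      unfolding abs_mult[of "ln_circle w s"] by (intro mult_mono bound norm_sign_harmonic_le order_trans[OF abs_ge_zero bound]) auto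
    show "(\<lambda>m. ln_circle w s * (?c m * harmonic w m s)) sums (ln_circle w s * ln_circle w s)" for s
      by (intro sums_mult ln_circle_sums w)
    have "(cmod w)\<^sup>2 \<le> 1" using w by (simp add: abs_square_le_1)
    then have "(\<lambda>n. ((cmod w)\<^sup>2) ^ Suc n / (real (Suc n))\<^sup>2) sums Li2 ((cmod w)\<^sup>2)"
      unfolding Li2_def by (intro summable_sums summable_Li2) simp
    from sums_divide[OF this, of 2]
    show "(\<lambda>m. ?c m * (?c m * ((cmod w ^ Suc m)\<^sup>2 / 2))) sums (Li2 ((cmod w)\<^sup>2) / 2)"
      by (simp add: power2_eq_square power_mult_distrib mult_ac flip: power_mult_distrib del: of_nat_Suc)
  qed (intro continuous_intros continuous_on_harmonic cont summable_mult sM)+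
  then show ?thesis by (simp add: power2_eq_square)
qed

text \<open>The mean value property of \<open>ln \<bar>1 + z\<bar>\<close> at 0; it removes the
  cross term when w lies outside the unit circle.\<close>

lemma has_integral_ln_circle:
  assumes w: "cmod w < 1"
  shows "(ln_circle w has_integral 0) {0..1}"
proof (rule has_integral_sums)
  show "((\<lambda>s. (-1) ^ n / real (Suc n) * harmonic w n s) has_integral 0) {0..1}" for n
    using has_integral_mult_right[OF has_integral_harmonic, of "(-1) ^ n / real (Suc n)" w n] by (simp only: mult_zero_right)
  show "summable (\<lambda>n. cmod w ^ Suc n)" using w by (intro summable_Suc_power) auto
  show "\<bar>(-1) ^ n / real (Suc n) * harmonic w n s\<bar> \<le> cmod w ^ Suc n" for n s by (rule norm_sign_harmonic_le)
qed (intro continuous_intros continuous_on_harmonic ln_circle_sums w sums_zero)+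

text \<open>The mean of \<open>(ln \<bar>w + y\<bar>)^2\<close> over
  \<open>\<bar>y\<bar> = 1\<close> when \<open>\<bar>w\<bar> = r\<close>.\<close>

definition mean_log2 :: "real \<Rightarrow> real" where
  "mean_log2 r = (if r < 1 then Li2 (r\<^sup>2) / 2 else (ln r)\<^sup>2 + Li2 ((1 / r)\<^sup>2) / 2)"

text \<open>Inside the unit circle, conjugation and multiplication by the unimodular y turn
  \<open>\<bar>w + y\<bar>\<close> into \<open>\<bar>1 + cnj w * y\<bar>\<close>. Outside, w is
  factored out and the square expanded.\<close>

lemma has_integral_mean_log2:
  assumes "cmod w \<noteq> 1"
  shows "((\<lambda>s. (ln (cmod (w + cis (2 * pi * s))))\<^sup>2) has_integral mean_log2 (cmod w)) {0..1}"
proof (cases "cmod w < 1")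
  case True
  have "cmod (w + cis (2 * pi * s)) = cmod (1 + cnj w * cis (2 * pi * s))" for s
  proof -
    have "cmod (1 + cnj w * cis (2 * pi * s)) = cmod (cnj (1 + cnj w * cis (2 * pi * s)) * cis (2 * pi * s))"
      unfolding norm_mult complex_mod_cnj norm_cis by simp
    also have "cnj (1 + cnj w * cis (2 * pi * s)) * cis (2 * pi * s) = w + cis (2 * pi * s)"
      by (simp add: cis_cnj algebra_simps cis_mult)
    finally show ?thesis by simp
  qed
  then show ?thesis using has_integral_ln_circle_squared[of "cnj w"] True
    by (simp add: ln_circle_def mean_log2_def)
next
  case False
  then have w: "1 < cmod w" "w \<noteq> 0" using assms by auto
  then have w1: "cmod (1 / w) < 1" by (simp add: norm_divide)
  have e: "ln (cmod (w + cis (2 * pi * s))) = ln (cmod w) + ln_circle (1 / w) s" for s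
  proof -
    have "1 + 1 / w * cis (2 * pi * s) \<noteq> 0"
    proof
      assume "1 + 1 / w * cis (2 * pi * s) = 0"
      then have "1 / w * cis (2 * pi * s) = - 1" by (simp add: add_eq_0_iff)
      then have "cmod (1 / w * cis (2 * pi * s)) = 1" by (simp only: norm_minus_cancel norm_one)
      with w1 show False by (simp only: norm_mult norm_cis)
    qed
    moreover have "w + cis (2 * pi * s) = w * (1 + 1 / w * cis (2 * pi * s))"
      using w by (simp add: field_simps)
    ultimately show ?thesis unfolding ln_circle_def using w
      by (simp add: norm_mult ln_mult_pos)
  qed
  have eq: "(ln (cmod (w + cis (2 * pi * s))))\<^sup>2 =
    (ln (cmod w))\<^sup>2 + 2 * ln (cmod w) * ln_circle (1 / w) s + (ln_circle (1 / w) s)\<^sup>2" for s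
    unfolding e by (simp add: power2_eq_square algebra_simps)
  have "((\<lambda>s::real. (ln (cmod w))\<^sup>2) has_integral (ln (cmod w))\<^sup>2) {0..1}"
    by (rule has_integral_eq_rhs[OF has_integral_const_real]) simp
  then have "((\<lambda>s. (ln (cmod w))\<^sup>2 + 2 * ln (cmod w) * ln_circle (1 / w) s + (ln_circle (1 / w) s)\<^sup>2) has_integral
    ((ln (cmod w))\<^sup>2 + 2 * ln (cmod w) * 0 + Li2 ((cmod (1 / w))\<^sup>2) / 2)) {0..1}"
    by (intro has_integral_add has_integral_mult_right has_integral_ln_circle[OF w1] has_integral_ln_circle_squared[OF w1])
  then show ?thesis unfolding eq using w by (simp add: mean_log2_def norm_divide)
qed

section \<open>The kernel\<close>

lemma sin_diff_mult_sin_add: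
  "sin (a - b) * sin (a + b) = (sin a)\<^sup>2 - (sin b)\<^sup>2" for a b :: real
proof -
  have "sin (a - b) * sin (a + b) = (sin a)\<^sup>2 * (cos b)\<^sup>2 - (cos a)\<^sup>2 * (sin b)\<^sup>2"
    by (simp add: sin_diff sin_add power2_eq_square algebra_simps)
  also have "\<dots> = (sin a)\<^sup>2 - (sin b)\<^sup>2" by (simp add: cos_squared_eq algebra_simps)
  finally show ?thesis .
qed

text \<open>With \<open>x = (sin b)\<^sup>2 / (sin a)\<^sup>2\<close>, the term
  \<open>ln (1 - x)\<close> is the one in the derivative of \<open>Li2\<close>; this ties the kernel
  to the dilogarithm.\<close>

lemma lsin_add_lsin_eq:
  assumes "0 \<le> b" "b < a" "a \<le> pi / 2"
  shows "lsin (a - b) + lsin (a + b) = 2 * lsin a + ln (1 - (sin b)\<^sup>2 / (sin a)\<^sup>2)"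
    and "(sin b)\<^sup>2 / (sin a)\<^sup>2 < 1"
proof -
  have "sin b < sin a" "0 \<le> sin b" using assms by (auto intro!: sin_monotone_2pi sin_ge_zero)
  then have "(sin b)\<^sup>2 < (sin a)\<^sup>2" by (intro power_strict_mono) auto
  have sa: "0 < sin a" using \<open>sin b < sin a\<close> \<open>0 \<le> sin b\<close> by linarith
  show q: "(sin b)\<^sup>2 / (sin a)\<^sup>2 < 1" using \<open>(sin b)\<^sup>2 < (sin a)\<^sup>2\<close> sa by simp
  have "0 < sin (a - b)" "0 < sin (a + b)" using assms by (auto intro!: sin_gt_zero)
  then have "lsin (a - b) + lsin (a + b) = ln ((2 * sin (a - b)) * (2 * sin (a + b)))"
    unfolding lsin_def by (intro ln_mult_pos[symmetric]) auto
  also have "(2 * sin (a - b)) * (2 * sin (a + b)) = 4 * ((sin a)\<^sup>2 - (sin b)\<^sup>2)"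
    unfolding sin_diff_mult_sin_add[symmetric] by simp
  also have "\<dots> = (2 * sin a)\<^sup>2 * (1 - (sin b)\<^sup>2 / (sin a)\<^sup>2)"
    using sa by (simp add: field_simps)
  also have "ln \<dots> = ln ((2 * sin a)\<^sup>2) + ln (1 - (sin b)\<^sup>2 / (sin a)\<^sup>2)"
    using q sa by (intro ln_mult_pos) auto
  also have "ln ((2 * sin a)\<^sup>2) = 2 * lsin a" unfolding lsin_def using sa by (subst ln_realpow) auto
  finally show "lsin (a - b) + lsin (a + b) = 2 * lsin a + ln (1 - (sin b)\<^sup>2 / (sin a)\<^sup>2)" .
qed

text \<open>The antiderivative is \<open>Li2 x / 2\<close> with
  \<open>x = (sin \<alpha>)\<^sup>2 / (sin \<phi>)\<^sup>2\<close>, since x'/x is twice the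
  cotangent of \<alpha>. Continuity of \<open>Li2\<close> at 1 allows
  \<open>b = \<phi>\<close>.\<close>

lemma has_integral_kern_below:
  assumes "0 \<le> b" "b \<le> \<phi>" "0 < \<phi>" "\<phi> \<le> pi / 2"
  shows "((\<lambda>\<alpha>. cos \<alpha> / sin \<alpha> * (2 * lsin \<phi> - lsin (\<phi> - \<alpha>) - lsin (\<phi> + \<alpha>))) has_integral
     Li2 ((sin b)\<^sup>2 / (sin \<phi>)\<^sup>2) / 2) {0..b}"
proof -
  have s\<phi>: "0 < sin \<phi>" using assms by (intro sin_gt_zero) auto
  let ?x = "\<lambda>\<alpha>. (sin \<alpha>)\<^sup>2 / (sin \<phi>)\<^sup>2"
  let ?W = "\<lambda>\<alpha>. Li2 (?x \<alpha>) / 2"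
  have "(sin \<alpha>)\<^sup>2 \<le> (sin \<phi>)\<^sup>2" if "\<alpha> \<in> {0..b}" for \<alpha>
    using that assms by (intro power_mono sin_monotone_2pi_le sin_ge_zero) auto
  then have "continuous_on {0..b} ?W"
    using s\<phi> by (intro continuous_intros continuous_on_compose2[OF continuous_on_Li2]) auto
  moreover have "(?W has_real_derivative cos \<alpha> / sin \<alpha> * (2 * lsin \<phi> - lsin (\<phi> - \<alpha>) - lsin (\<phi> + \<alpha>))) (at \<alpha>)"
    if "\<alpha> \<in> {0<..<b}" for \<alpha>
  proof -
    have a: "0 \<le> \<alpha>" "\<alpha> < \<phi>" using that assms by auto
    have s\<alpha>: "0 < sin \<alpha>" using that assms by (intro sin_gt_zero) auto
    have "0 < ?x \<alpha>" "?x \<alpha> < 1" using lsin_add_lsin_eq(2)[OF a assms(4)] s\<alpha> s\<phi> by auto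
    then have L: "(Li2 has_real_derivative - ln (1 - ?x \<alpha>) / ?x \<alpha>) (at (?x \<alpha>))"
      by (intro has_real_derivative_Li2) auto
    have X: "(?x has_real_derivative 2 * sin \<alpha> * cos \<alpha> / (sin \<phi>)\<^sup>2) (at \<alpha>)"
      using s\<phi> by (auto intro!: derivative_eq_intros simp: power2_eq_square field_simps)
    from DERIV_cdivide[OF DERIV_chain2[OF L X], of 2]
    have "(?W has_real_derivative - ln (1 - ?x \<alpha>) / ?x \<alpha> * (2 * sin \<alpha> * cos \<alpha> / (sin \<phi>)\<^sup>2) / 2) (at \<alpha>)" .
    moreover have "- l / (u\<^sup>2 / v\<^sup>2) * (2 * u * c / v\<^sup>2) / 2 = c / u * (- l)" if "0 < u" "0 < v" for l u c v :: real
      using that by (simp add: field_simps power2_eq_square)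
    from this[OF s\<alpha> s\<phi>] have "- ln (1 - ?x \<alpha>) / ?x \<alpha> * (2 * sin \<alpha> * cos \<alpha> / (sin \<phi>)\<^sup>2) / 2
        = cos \<alpha> / sin \<alpha> * (- ln (1 - ?x \<alpha>))" .
    moreover have "2 * lsin \<phi> - lsin (\<phi> - \<alpha>) - lsin (\<phi> + \<alpha>) = - ln (1 - ?x \<alpha>)"
      using lsin_add_lsin_eq(1)[OF a assms(4)] by linarith
    ultimately show ?thesis by (simp only:)
  qed
  ultimately have "((\<lambda>\<alpha>. cos \<alpha> / sin \<alpha> * (2 * lsin \<phi> - lsin (\<phi> - \<alpha>) - lsin (\<phi> + \<alpha>))) has_integral (?W b - ?W 0)) {0..b}"
    using assms(1) by (intro fundamental_theorem_of_calculus_interior)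
      (simp_all flip: has_real_derivative_iff_has_vector_derivative)
  then show ?thesis by simp
qed

text \<open>Here the quotient is inverted and the antiderivative gains
  \<open>(lsin \<alpha>)\<^sup>2\<close>. At \<open>pi / 6\<close> that square vanishes because
  \<open>2 * sin (pi / 6) = 1\<close>; at \<phi> the dilogarithm is \<open>Li2 1\<close>.\<close>

lemma has_integral_kern_above:
  assumes "0 < \<phi>" "\<phi> \<le> pi / 6"
  shows "((\<lambda>\<alpha>. cos \<alpha> / sin \<alpha> * (lsin (\<alpha> - \<phi>) + lsin (\<phi> + \<alpha>))) has_integral
     Li2 ((2 * sin \<phi>)\<^sup>2) / 2 - ((lsin \<phi>)\<^sup>2 + pi\<^sup>2 / 12)) {\<phi>..pi / 6}"
proof -
  have s\<phi>: "0 < sin \<phi>" using assms by (intro sin_gt_zero) auto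
  let ?x = "\<lambda>\<alpha>. (sin \<phi>)\<^sup>2 / (sin \<alpha>)\<^sup>2"
  let ?W = "\<lambda>\<alpha>. (lsin \<alpha>)\<^sup>2 + Li2 (?x \<alpha>) / 2"
  have s\<alpha>: "0 < sin \<alpha>" if "\<alpha> \<in> {\<phi>..pi / 6}" for \<alpha>
    using that assms by (intro sin_gt_zero) auto
  have "(sin \<phi>)\<^sup>2 \<le> (sin \<alpha>)\<^sup>2" if "\<alpha> \<in> {\<phi>..pi / 6}" for \<alpha>
    using that assms by (intro power_mono sin_monotone_2pi_le sin_ge_zero) auto
  then have "?x \<alpha> \<le> 1" if "\<alpha> \<in> {\<phi>..pi / 6}" for \<alpha>
    using s\<alpha>[OF that] that by simp
  then have "?x ` {\<phi>..pi / 6} \<subseteq> cball 0 1" by auto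
  moreover have "continuous_on {\<phi>..pi / 6} lsin"
    using has_real_derivative_lsin[OF s\<alpha>] by (intro continuous_at_imp_continuous_on ballI DERIV_isCont) auto
  moreover have "\<forall>\<alpha>\<in>{\<phi>..pi / 6}. (sin \<alpha>)\<^sup>2 \<noteq> 0" using s\<alpha> by fastforce
  ultimately have "continuous_on {\<phi>..pi / 6} ?W"
    by (intro continuous_intros continuous_on_compose2[OF continuous_on_Li2]) auto
  moreover have "(?W has_real_derivative cos \<alpha> / sin \<alpha> * (lsin (\<alpha> - \<phi>) + lsin (\<phi> + \<alpha>))) (at \<alpha>)"
    if "\<alpha> \<in> {\<phi><..<pi / 6}" for \<alpha>
  proof -
    have a: "0 \<le> \<phi>" "\<phi> < \<alpha>" "\<alpha> \<le> pi / 2" using that assms pi_gt_zero by auto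
    have s: "0 < sin \<alpha>" using that by (intro s\<alpha>) auto
    have "0 < ?x \<alpha>" "?x \<alpha> < 1" using lsin_add_lsin_eq(2)[OF a] s s\<phi> by auto
    then have L: "(Li2 has_real_derivative - ln (1 - ?x \<alpha>) / ?x \<alpha>) (at (?x \<alpha>))"
      by (intro has_real_derivative_Li2) auto
    have X: "(?x has_real_derivative - 2 * (cos \<alpha> / sin \<alpha>) * ?x \<alpha>) (at \<alpha>)"
      using s by (auto intro!: derivative_eq_intros simp: power2_eq_square field_simps)
    have "((\<lambda>\<alpha>. (lsin \<alpha>)\<^sup>2) has_real_derivative 2 * lsin \<alpha> * (cos \<alpha> / sin \<alpha>)) (at \<alpha>)"
      using has_real_derivative_lsin[OF s] by (auto intro!: derivative_eq_intros)
    from DERIV_add[OF this DERIV_cdivide[OF DERIV_chain2[OF L X], of 2]]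
    have "(?W has_real_derivative 2 * lsin \<alpha> * (cos \<alpha> / sin \<alpha>) +
       - ln (1 - ?x \<alpha>) / ?x \<alpha> * (- 2 * (cos \<alpha> / sin \<alpha>) * ?x \<alpha>) / 2) (at \<alpha>)" .
    moreover have "2 * l * c + - m / x * (- 2 * c * x) / 2 = c * (2 * l + m)" if "0 < x" for l c m x :: real
      using that by (simp add: field_simps)
    from this[OF \<open>0 < ?x \<alpha>\<close>] have "2 * lsin \<alpha> * (cos \<alpha> / sin \<alpha>) +
       - ln (1 - ?x \<alpha>) / ?x \<alpha> * (- 2 * (cos \<alpha> / sin \<alpha>) * ?x \<alpha>) / 2
       = cos \<alpha> / sin \<alpha> * (2 * lsin \<alpha> + ln (1 - ?x \<alpha>))" .
    moreover have "lsin (\<alpha> - \<phi>) + lsin (\<phi> + \<alpha>) = 2 * lsin \<alpha> + ln (1 - ?x \<alpha>)"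
      using lsin_add_lsin_eq(1)[OF a] by (simp add: add.commute)
    ultimately show ?thesis by (simp only:)
  qed
  ultimately have "((\<lambda>\<alpha>. cos \<alpha> / sin \<alpha> * (lsin (\<alpha> - \<phi>) + lsin (\<phi> + \<alpha>))) has_integral (?W (pi / 6) - ?W \<phi>)) {\<phi>..pi / 6}"
    using assms(2) by (intro fundamental_theorem_of_calculus_interior)
      (simp_all flip: has_real_derivative_iff_has_vector_derivative)
  moreover have "?W (pi / 6) = Li2 ((2 * sin \<phi>)\<^sup>2) / 2"
    by (simp add: sin_30 lsin_def power_mult_distrib power_divide mult.commute)
  moreover have "?W \<phi> = (lsin \<phi>)\<^sup>2 + pi\<^sup>2 / 12" using s\<phi> by (simp add: Li2_1)
  ultimately show ?thesis by (simp only:)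
qed

text \<open>
  The derivative with respect to alpha of the mean of \<open>ln\<^sup>2 \<bar>w + 2 sin \<alpha> y\<bar>\<close>
  over the circle \<open>\<bar>y\<bar> = 1\<close>, where \<open>\<bar>w\<bar> = 2 sin \<phi>\<close>.
\<close>
definition kern :: "real \<Rightarrow> real \<Rightarrow> real" where
  "kern \<phi> \<alpha> = cos \<alpha> / sin \<alpha> *
     (if \<alpha> < \<phi> then 2 * lsin \<phi> - lsin (\<phi> - \<alpha>) - lsin (\<phi> + \<alpha>) else lsin (\<alpha> - \<phi>) + lsin (\<phi> + \<alpha>))"

lemma cot_nonneg: "0 \<le> \<alpha> \<Longrightarrow> \<alpha> \<le> pi / 2 \<Longrightarrow> 0 \<le> cos \<alpha> / sin \<alpha>"
  by (intro divide_nonneg_nonneg cos_ge_zero sin_ge_zero) auto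

text \<open>The bracket is \<open>- ln (1 - x)\<close> with x in [0, 1). The sign makes the absolute
  integral of the kernel explicit.\<close>

lemma kern_nonneg:
  assumes "0 \<le> \<alpha>" "\<alpha> < \<phi>" "\<phi> \<le> pi / 2"
  shows "0 \<le> kern \<phi> \<alpha>"
proof -
  have "0 < sin \<phi>" using assms by (intro sin_gt_zero) auto
  then have "ln (1 - (sin \<alpha>)\<^sup>2 / (sin \<phi>)\<^sup>2) \<le> 0"
    using lsin_add_lsin_eq(2)[OF assms] ln_le_minus_one[of "1 - (sin \<alpha>)\<^sup>2 / (sin \<phi>)\<^sup>2"]
    by (intro order_trans[OF ln_le_minus_one]) auto
  then have "0 \<le> 2 * lsin \<phi> - lsin (\<phi> - \<alpha>) - lsin (\<phi> + \<alpha>)" using lsin_add_lsin_eq(1)[OF assms] by linarith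
  then have "0 \<le> cos \<alpha> / sin \<alpha> * (2 * lsin \<phi> - lsin (\<phi> - \<alpha>) - lsin (\<phi> + \<alpha>))"
    using assms by (intro mult_nonneg_nonneg cot_nonneg) auto
  then show ?thesis using assms(2) by (simp only: kern_def if_True)
qed

text \<open>The two sines multiply to at most \<open>(sin \<alpha>)\<^sup>2 \<le> 1 / 4\<close>, so
  the combined logarithm has argument at most 1; this is where \<open>\<alpha> \<le> pi / 6\<close>
  enters.\<close>

lemma kern_nonpos:
  assumes "0 \<le> \<phi>" "\<phi> < \<alpha>" "\<alpha> \<le> pi / 6"
  shows "kern \<phi> \<alpha> \<le> 0"
proof -
  have a: "\<alpha> \<le> pi / 2" using assms pi_gt_zero by linarith
  have s: "0 < sin (\<alpha> - \<phi>)" "0 < sin (\<alpha> + \<phi>)" "0 \<le> sin \<alpha>" "sin \<alpha> \<le> sin (pi / 6)"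
    using assms by (auto intro!: sin_gt_zero sin_ge_zero sin_monotone_2pi_le)
  then have "(sin \<alpha>)\<^sup>2 \<le> (1 / 2)\<^sup>2" unfolding sin_30 by (intro power_mono)
  then have "sin (\<alpha> - \<phi>) * sin (\<alpha> + \<phi>) \<le> 1 / 4"
    unfolding sin_diff_mult_sin_add power2_eq_square[of "1 / 2 :: real"] using zero_le_power2[of "sin \<phi>"] by linarith
  then have "ln ((2 * sin (\<alpha> - \<phi>)) * (2 * sin (\<alpha> + \<phi>))) \<le> 0"
    using s by (intro ln_le_zero_iff[THEN iffD2]) auto
  moreover have "ln ((2 * sin (\<alpha> - \<phi>)) * (2 * sin (\<alpha> + \<phi>))) = lsin (\<alpha> - \<phi>) + lsin (\<alpha> + \<phi>)"
    unfolding lsin_def using s by (intro ln_mult_pos) auto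
  ultimately have "lsin (\<alpha> - \<phi>) + lsin (\<phi> + \<alpha>) \<le> 0" by (simp add: add.commute)
  then have "cos \<alpha> / sin \<alpha> * (lsin (\<alpha> - \<phi>) + lsin (\<phi> + \<alpha>)) \<le> 0"
    using a assms by (intro mult_nonneg_nonpos cot_nonneg) auto
  moreover have "\<not> \<alpha> < \<phi>" using assms by simp
  ultimately show ?thesis by (simp only: kern_def if_False)
qed

text \<open>As the radius \<open>2 * sin \<alpha>\<close> grows from 0 to 1, the circle mean moves
  from \<open>(lsin \<phi>)\<^sup>2\<close> to \<open>mean_log2 (2 * sin \<phi>)\<close>. The kernel
  changes sign only at \<open>\<alpha> = \<phi>\<close>, so splitting there also gives its absolute
  integral and the bound for Fubini.\<close>

lemma has_integral_kern:
  assumes \<phi>: "0 < \<phi>" "\<phi> \<le> pi / 2" "\<phi> \<noteq> pi / 6"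
  obtains N where
    "(kern \<phi> has_integral mean_log2 (2 * sin \<phi>) - (lsin \<phi>)\<^sup>2) {0..pi / 6}"
    "((\<lambda>\<alpha>. \<bar>kern \<phi> \<alpha>\<bar>) has_integral N) {0..pi / 6}" "N \<le> pi\<^sup>2 / 6 + (lsin \<phi>)\<^sup>2"
proof -
  have s\<phi>: "0 < sin \<phi>" using \<phi> by (intro sin_gt_zero) auto
  have below: "(kern \<phi> has_integral Li2 ((sin b)\<^sup>2 / (sin \<phi>)\<^sup>2) / 2) {0..b}"
    "((\<lambda>\<alpha>. \<bar>kern \<phi> \<alpha>\<bar>) has_integral Li2 ((sin b)\<^sup>2 / (sin \<phi>)\<^sup>2) / 2) {0..b}"
    if b: "0 \<le> b" "b \<le> \<phi>" for b
  proof -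
    have "kern \<phi> \<alpha> = cos \<alpha> / sin \<alpha> * (2 * lsin \<phi> - lsin (\<phi> - \<alpha>) - lsin (\<phi> + \<alpha>))"
      if "\<alpha> \<in> {0..b} - {\<phi>}" for \<alpha> using that b by (simp add: kern_def)
    from has_integral_spike_finite[where S = "{\<phi>}", OF _ this has_integral_kern_below[OF b \<phi>(1,2)]]
    show *: "(kern \<phi> has_integral Li2 ((sin b)\<^sup>2 / (sin \<phi>)\<^sup>2) / 2) {0..b}" by simp
    have "\<bar>kern \<phi> \<alpha>\<bar> = kern \<phi> \<alpha>" if "\<alpha> \<in> {0..b} - {\<phi>}" for \<alpha>
      using that b \<phi> by (intro abs_of_nonneg kern_nonneg) auto
    from has_integral_spike_finite[where S = "{\<phi>}", OF _ this *]
    show "((\<lambda>\<alpha>. \<bar>kern \<phi> \<alpha>\<bar>) has_integral Li2 ((sin b)\<^sup>2 / (sin \<phi>)\<^sup>2) / 2) {0..b}" by simp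
  qed
  show ?thesis
  proof (cases "\<phi> < pi / 6")
    case True
    let ?L = "Li2 ((2 * sin \<phi>)\<^sup>2) / 2"
    have "sin \<phi> < sin (pi / 6)" using True \<phi> by (intro sin_monotone_2pi) auto
    then have l: "2 * sin \<phi> < 1" by (simp add: sin_30)
    then have "(2 * sin \<phi>)\<^sup>2 \<le> 1" using s\<phi> by (intro power_le_one) auto
    then have L: "0 \<le> ?L" using Li2_bounds(1)[of "(2 * sin \<phi>)\<^sup>2"] by simp
    have "kern \<phi> \<alpha> = cos \<alpha> / sin \<alpha> * (lsin (\<alpha> - \<phi>) + lsin (\<phi> + \<alpha>))"
      if "\<alpha> \<in> {\<phi>..pi / 6} - {}" for \<alpha> using that by (simp add: kern_def)
    from has_integral_spike_finite[where S = "{}", OF _ this has_integral_kern_above] True \<phi>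
    have above: "(kern \<phi> has_integral ?L - ((lsin \<phi>)\<^sup>2 + pi\<^sup>2 / 12)) {\<phi>..pi / 6}" by simp
    have "\<bar>kern \<phi> \<alpha>\<bar> = - kern \<phi> \<alpha>" if "\<alpha> \<in> {\<phi>..pi / 6} - {\<phi>}" for \<alpha>
      using that \<phi> by (intro abs_of_nonpos kern_nonpos) auto
    from has_integral_spike_finite[where S = "{\<phi>}", OF _ this has_integral_neg[OF above]]
    have above': "((\<lambda>\<alpha>. \<bar>kern \<phi> \<alpha>\<bar>) has_integral - (?L - ((lsin \<phi>)\<^sup>2 + pi\<^sup>2 / 12))) {\<phi>..pi / 6}" by simp
    have 1: "(sin \<phi>)\<^sup>2 / (sin \<phi>)\<^sup>2 = 1" using s\<phi> by simp
    note b = below[of \<phi>, unfolded 1 Li2_1]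
    show ?thesis
    proof (rule that)
      have "(kern \<phi> has_integral pi\<^sup>2 / 6 / 2 + (?L - ((lsin \<phi>)\<^sup>2 + pi\<^sup>2 / 12))) {0..pi / 6}"
        using has_integral_combine[OF _ _ b(1) above] True \<phi> by simp
      \<comment> \<open>The \<open>pi\<^sup>2 / 12\<close> gained up to \<phi> cancels the one lost
        beyond it.\<close>
      moreover have "pi\<^sup>2 / 6 / 2 + (?L - ((lsin \<phi>)\<^sup>2 + pi\<^sup>2 / 12)) = mean_log2 (2 * sin \<phi>) - (lsin \<phi>)\<^sup>2"
        using l by (simp add: mean_log2_def)
      ultimately show "(kern \<phi> has_integral mean_log2 (2 * sin \<phi>) - (lsin \<phi>)\<^sup>2) {0..pi / 6}" by (simp only:)
      show "((\<lambda>\<alpha>. \<bar>kern \<phi> \<alpha>\<bar>) has_integral pi\<^sup>2 / 6 / 2 + - (?L - ((lsin \<phi>)\<^sup>2 + pi\<^sup>2 / 12))) {0..pi / 6}"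
        using has_integral_combine[OF _ _ b(2) above'] True \<phi> by simp
      show "pi\<^sup>2 / 6 / 2 + - (?L - ((lsin \<phi>)\<^sup>2 + pi\<^sup>2 / 12)) \<le> pi\<^sup>2 / 6 + (lsin \<phi>)\<^sup>2" using L by simp
    qed
  next
    case False
    then have g: "pi / 6 < \<phi>" using \<phi> by simp
    have "sin (pi / 6) < sin \<phi>" using g \<phi> by (intro sin_monotone_2pi) auto
    then have l: "1 < 2 * sin \<phi>" by (simp add: sin_30)
    have e: "(sin (pi / 6))\<^sup>2 / (sin \<phi>)\<^sup>2 = (1 / (2 * sin \<phi>))\<^sup>2"
      by (simp add: sin_30 power_divide power_mult_distrib)
    note b = below[of "pi / 6", unfolded e]
    have "(1 / (2 * sin \<phi>))\<^sup>2 \<le> 1" using l s\<phi> by (intro power_le_one) auto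
    then have "Li2 ((1 / (2 * sin \<phi>))\<^sup>2) \<le> pi\<^sup>2 / 6" using Li2_bounds(2)[of "(1 / (2 * sin \<phi>))\<^sup>2"] by simp
    moreover have "mean_log2 (2 * sin \<phi>) - (lsin \<phi>)\<^sup>2 = Li2 ((1 / (2 * sin \<phi>))\<^sup>2) / 2"
      using l by (simp add: mean_log2_def lsin_def)
    ultimately show ?thesis
    proof (intro that)
      assume e2: "mean_log2 (2 * sin \<phi>) - (lsin \<phi>)\<^sup>2 = Li2 ((1 / (2 * sin \<phi>))\<^sup>2) / 2"
      show "(kern \<phi> has_integral mean_log2 (2 * sin \<phi>) - (lsin \<phi>)\<^sup>2) {0..pi / 6}"
        unfolding e2 using b(1) g by simp
      show "((\<lambda>\<alpha>. \<bar>kern \<phi> \<alpha>\<bar>) has_integral Li2 ((1 / (2 * sin \<phi>))\<^sup>2) / 2) {0..pi / 6}"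
        using b(2) g by simp
      assume "Li2 ((1 / (2 * sin \<phi>))\<^sup>2) \<le> pi\<^sup>2 / 6"
      then show "Li2 ((1 / (2 * sin \<phi>))\<^sup>2) / 2 \<le> pi\<^sup>2 / 6 + (lsin \<phi>)\<^sup>2"
        using zero_le_power2[of "lsin \<phi>"] zero_le_power2[of pi] by linarith
    qed
  qed
qed

section \<open>Fubini's theorem on rectangles\<close>

text \<open>Bridge from gauge integrals to Lebesgue integrals, hence the demand on the absolute
  value; Borel measurability allows passing from the completed measure to
  \<open>lborel\<close>.\<close>

lemma has_bochner_integral_Icc:
  fixes f :: "real \<Rightarrow> real"
  assumes [measurable]: "f \<in> borel_measurable borel"
    and f: "(f has_integral I) {a..b}" "(\<lambda>x. \<bar>f x\<bar>) integrable_on {a..b}"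
  shows "has_bochner_integral lborel (\<lambda>x. indicator {a..b} x * f x) I"
proof -
  have "f absolutely_integrable_on {a..b}"
    using f by (intro absolutely_integrable_onI) auto
  then have *: "set_integrable lborel {a..b} f"
    unfolding set_integrable_def by (subst (asm) integrable_completion) auto
  then have "integral\<^sup>L lborel (\<lambda>x. indicator {a..b} x * f x) = I"
    using set_borel_integral_eq_integral(2)[OF *] integral_unique[OF f(1)]
    by (simp add: set_lebesgue_integral_def)
  with * show ?thesis by (simp add: has_bochner_integral_iff set_integrable_def)
qed

lemma has_integral_Icc_of_AE:
  fixes F :: "real \<Rightarrow> real"
  assumes "integrable lborel f" "AE x in lborel. f x = indicator {a..b} x * F x"
  shows "(F has_integral integral\<^sup>L lborel f) {a..b}"
proof -
  have "(f has_integral integral\<^sup>L lborel f) UNIV" by (rule has_integral_integral_lborel[OF assms(1)])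
  then have "((\<lambda>x. indicator {a..b} x * F x) has_integral integral\<^sup>L lborel f) UNIV"
    using assms(2) by (subst (asm) has_integral_AE[where g = "\<lambda>x. indicator {a..b} x * F x"]) auto
  then have "((\<lambda>x. if x \<in> {a..b} then F x else 0) has_integral integral\<^sup>L lborel f) UNIV"
    by (rule has_integral_eq[rotated]) auto
  then show ?thesis by (simp only: has_integral_restrict_UNIV)
qed

lemma AE_lborel_finite:
  assumes "finite S" shows "AE x in lborel. x \<notin> (S :: real set)"
  using assms by (intro AE_not_in) (auto simp: finite_imp_null_set_lborel)

text \<open>Extension by zero, so that Fubini can be applied on the whole plane with the product of
  two copies of \<open>lborel\<close>.\<close>

definition on_rect :: "real set \<Rightarrow> real set \<Rightarrow> (real \<Rightarrow> real \<Rightarrow> real) \<Rightarrow> real \<Rightarrow> real \<Rightarrow> real" where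
  "on_rect A B f x y = indicator A x * (indicator B y * f x y)"

text \<open>
  Joint integrability comes from the rows alone, whose absolute integrals are dominated by h;
  no absolute integrability of the columns has to be checked.
\<close>
context
  fixes f :: "real \<Rightarrow> real \<Rightarrow> real" and a b c d :: real and F N h :: "real \<Rightarrow> real" and S :: "real set"
  assumes meas [measurable]: "case_prod f \<in> borel_measurable (borel \<Otimes>\<^sub>M borel)"
    and S: "finite S"
    and row: "\<And>x. x \<in> {a..b} - S \<Longrightarrow> (f x has_integral F x) {c..d}"
      "\<And>x. x \<in> {a..b} - S \<Longrightarrow> ((\<lambda>y. \<bar>f x y\<bar>) has_integral N x) {c..d}"
      "\<And>x. x \<in> {a..b} - S \<Longrightarrow> N x \<le> h x"
    and h [measurable]: "h \<in> borel_measurable borel"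
    and h_int: "h integrable_on {a..b}" and h_nonneg: "\<And>x. x \<in> {a..b} \<Longrightarrow> 0 \<le> h x"
begin

abbreviation (input) g :: "real \<Rightarrow> real \<Rightarrow> real" where
  "g \<equiv> on_rect {a..b} {c..d} f"

lemma on_rect_measurable [measurable]: "case_prod g \<in> borel_measurable (lborel \<Otimes>\<^sub>M lborel)"
  unfolding on_rect_def by measurable

lemma row_measurable [measurable]: "f x \<in> borel_measurable borel"
  using measurable_Pair2[OF meas, of x] by simp

lemma on_rect_row: "x \<notin> S \<Longrightarrow> has_bochner_integral lborel (g x) (indicator {a..b} x * F x)"
proof (cases "x \<in> {a..b}")
  case True
  assume "x \<notin> S"
  then have "has_bochner_integral lborel (\<lambda>y. indicator {c..d} y * f x y) (F x)"
    using True row(1,2)[of x] by (intro has_bochner_integral_Icc) auto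
  then show ?thesis using True by (simp add: on_rect_def[abs_def] has_bochner_integral_zero)
qed (simp add: on_rect_def[abs_def] has_bochner_integral_zero)

lemma Fubini_integrable_Icc:
  "integrable (lborel \<Otimes>\<^sub>M lborel) (case_prod (on_rect {a..b} {c..d} f))"
  proof (rule lborel_pair.Fubini_integrable)
    have "integrable lborel (\<lambda>x. indicator {a..b} x * h x)"
      using has_bochner_integral_Icc[OF h integrable_integral[OF h_int]]
        integrable_eq[OF h_int, of "\<lambda>x. \<bar>h x\<bar>"] h_nonneg
      by (auto simp: has_bochner_integral_iff)
    then show "integrable lborel (\<lambda>x. \<integral>y. norm (case_prod g (x, y)) \<partial>lborel)"
    proof (rule Bochner_Integration.integrable_bound)
      show "(\<lambda>x. \<integral>y. norm (case_prod g (x, y)) \<partial>lborel) \<in> borel_measurable lborel"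
        by measurable
      show "AE x in lborel. norm (\<integral>y. norm (case_prod g (x, y)) \<partial>lborel) \<le> norm (indicator {a..b} x * h x)"
        using AE_lborel_finite[OF S]
      proof eventually_elim
        case (elim x)
        show ?case
        proof (cases "x \<in> {a..b}")
          case True
          have "has_bochner_integral lborel (\<lambda>y. indicator {c..d} y * \<bar>f x y\<bar>) (N x)"
            using True elim row(2)[of x] by (intro has_bochner_integral_Icc) auto
          moreover have "norm (case_prod g (x, y)) = indicator {c..d} y * \<bar>f x y\<bar>" for y
            using True by (simp add: on_rect_def abs_mult)
          ultimately have 1: "(\<integral>y. norm (case_prod g (x, y)) \<partial>lborel) = N x"
            by (simp add: has_bochner_integral_iff)
          have "0 \<le> (\<integral>y. norm (case_prod g (x, y)) \<partial>lborel)" by simp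
          then show ?thesis unfolding 1 using True elim row(3)[of x] by simp
        qed (simp add: on_rect_def)
      qed
    qed
    show "AE x in lborel. integrable lborel (\<lambda>y. case_prod g (x, y))"
      using AE_lborel_finite[OF S]
      by eventually_elim (use on_rect_row in \<open>auto simp: has_bochner_integral_iff\<close>)
  qed simp

lemma Fubini_row_Icc:
  "(F has_integral integral\<^sup>L (lborel \<Otimes>\<^sub>M lborel) (case_prod (on_rect {a..b} {c..d} f))) {a..b}"
proof -
  have int: "integrable (lborel \<Otimes>\<^sub>M lborel) (case_prod g)"
    by (rule Fubini_integrable_Icc)
  have "(F has_integral (\<integral>x. (\<integral>y. g x y \<partial>lborel) \<partial>lborel)) {a..b}"
  proof (rule has_integral_Icc_of_AE[OF lborel_pair.integrable_fst[OF int]])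
    show "AE x in lborel. (\<integral>y. g x y \<partial>lborel) = indicator {a..b} x * F x"
      using AE_lborel_finite[OF S]
      by eventually_elim (use on_rect_row in \<open>auto simp: has_bochner_integral_iff\<close>)
  qed
  then show ?thesis unfolding lborel_pair.integral_fst[OF int] .
qed

lemma Fubini_column_Icc:
  assumes "finite T" and col: "\<And>y. y \<in> {c..d} - T \<Longrightarrow> ((\<lambda>x. f x y) has_integral G y) {a..b}"
  shows "(G has_integral integral\<^sup>L (lborel \<Otimes>\<^sub>M lborel) (case_prod (on_rect {a..b} {c..d} f))) {c..d}"
proof -
  have int: "integrable (lborel \<Otimes>\<^sub>M lborel) (case_prod g)"
    by (rule Fubini_integrable_Icc)
  have "(G has_integral (\<integral>y. (\<integral>x. g x y \<partial>lborel) \<partial>lborel)) {c..d}"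
  proof (rule has_integral_Icc_of_AE[OF lborel_pair.integrable_snd[OF int]])
    show "AE y in lborel. (\<integral>x. g x y \<partial>lborel) = indicator {c..d} y * G y"
      \<comment> \<open>Joint integrability makes almost every column Lebesgue integrable, and there
        the gauge integral G has the same value.\<close>
      using AE_lborel_finite[OF \<open>finite T\<close>] lborel_pair.AE_integrable_snd[OF int]
    proof eventually_elim
      case (elim y)
      show ?case
      proof (cases "y \<in> {c..d}")
        case True
        then have eq: "(\<lambda>x. g x y) = (\<lambda>x. indicator {a..b} x *\<^sub>R f x y)" by (simp add: on_rect_def fun_eq_iff)
        have "set_integrable lborel {a..b} (\<lambda>x. f x y)"
          using elim(2) unfolding eq set_integrable_def .
        from set_borel_integral_eq_integral(2)[OF this] show ?thesis
          using integral_unique[OF col[of y]] True elim(1) by (simp add: eq set_lebesgue_integral_def)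
      qed (simp add: on_rect_def)
    qed
  qed
  then show ?thesis unfolding lborel_pair.integral_snd[OF int] .
qed

end

section \<open>Interchanging the integrals\<close>

lemma Li2_borel: "(Li2 :: real \<Rightarrow> real) \<in> borel_measurable borel"
  unfolding Li2_def by measurable

lemma mean_log2_borel [measurable]: "mean_log2 \<in> borel_measurable borel"
proof -
  have 1: "(\<lambda>r::real. Li2 (r\<^sup>2)) \<in> borel_measurable borel"
    by (rule measurable_compose[OF _ Li2_borel]) measurable
  have 2: "(\<lambda>r::real. Li2 ((1 / r)\<^sup>2)) \<in> borel_measurable borel"
    by (rule measurable_compose[OF _ Li2_borel]) measurable
  show ?thesis
    unfolding mean_log2_def by (intro measurable_If borel_measurable_divide borel_measurable_add 1 2) measurable
qed

lemma mean_log2_nonneg: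
  assumes "0 \<le> r" shows "0 \<le> mean_log2 r"
proof (cases "r < 1")
  case True
  then have "r\<^sup>2 \<le> 1" using assms by (intro power_le_one) auto
  then show ?thesis using True Li2_bounds(1)[of "r\<^sup>2"] by (simp add: mean_log2_def)
next
  case False
  then have "(1 / r)\<^sup>2 \<le> 1" by (intro power_le_one) auto
  then show ?thesis using False Li2_bounds(1)[of "(1 / r)\<^sup>2"] by (simp add: mean_log2_def)
qed

lemma kern_measurable: "case_prod kern \<in> borel_measurable (borel \<Otimes>\<^sub>M borel)"
  unfolding kern_def by measurable

lemma has_integral_shift:
  fixes f :: "real \<Rightarrow> real"
  assumes "(f has_integral I) {a + c..b + c}"
  shows "((\<lambda>x. f (x + c)) has_integral I) {a..b}"
  using has_integral_affinity'[of f I "a + c" "b + c" 1 c] assms by simp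

text \<open>For fixed \<alpha> the kernel is a combination of shifted and reflected copies of
  \<open>lsin\<close>, so only values of A occur. The antisymmetry A(pi/2 + \<alpha>) = - A(pi/2 -
  \<alpha>) removes those near pi/2.\<close>

lemma has_integral_kern_column:
  assumes \<alpha>: "0 < \<alpha>" "\<alpha> \<le> pi / 6"
  shows "((\<lambda>\<phi>. kern \<phi> \<alpha>) has_integral cos \<alpha> / sin \<alpha> * (2 * lsin_int (2 * \<alpha>) - 2 * lsin_int \<alpha>)) {0..pi / 2}"
proof -
  have b: "\<alpha> \<le> pi / 2" "2 * \<alpha> \<le> pi" using \<alpha> pi_gt_zero by linarith+
  let ?c = "cos \<alpha> / sin \<alpha>"
  have "((\<lambda>\<phi>. lsin (\<alpha> - \<phi>)) has_integral (lsin_int \<alpha> - lsin_int 0)) {\<alpha> - \<alpha>..\<alpha> - 0}"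
    using \<alpha> b by (intro has_integral_reflect_at has_integral_lsin) auto
  then have i1: "((\<lambda>\<phi>. lsin (\<alpha> - \<phi>)) has_integral (lsin_int \<alpha> - lsin_int 0)) {0..\<alpha>}" by simp
  have i2: "((\<lambda>\<phi>. lsin (\<phi> + \<alpha>)) has_integral (lsin_int (2 * \<alpha>) - lsin_int \<alpha>)) {0..\<alpha>}"
    using has_integral_lsin[of \<alpha> "2 * \<alpha>"] \<alpha> b by (intro has_integral_shift) simp
  have "((\<lambda>\<phi>. ?c * (lsin (\<alpha> - \<phi>) + lsin (\<phi> + \<alpha>))) has_integral
      ?c * ((lsin_int \<alpha> - lsin_int 0) + (lsin_int (2 * \<alpha>) - lsin_int \<alpha>))) {0..\<alpha>}"
    by (intro has_integral_mult_right has_integral_add i1 i2)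
  moreover have "kern \<phi> \<alpha> = ?c * (lsin (\<alpha> - \<phi>) + lsin (\<phi> + \<alpha>))" if "\<phi> \<in> {0..\<alpha>} - {}" for \<phi>
    using that by (simp add: kern_def)
  ultimately have l: "((\<lambda>\<phi>. kern \<phi> \<alpha>) has_integral ?c * ((lsin_int \<alpha> - lsin_int 0) + (lsin_int (2 * \<alpha>) - lsin_int \<alpha>))) {0..\<alpha>}"
    by (intro has_integral_spike_finite[where S = "{}" and g = "\<lambda>\<phi>. kern \<phi> \<alpha>"]) auto
  have j1: "(lsin has_integral (lsin_int (pi / 2) - lsin_int \<alpha>)) {\<alpha>..pi / 2}"
    using \<alpha> b by (intro has_integral_lsin) auto
  have j2: "((\<lambda>\<phi>. lsin (\<phi> + - \<alpha>)) has_integral (lsin_int (pi / 2 - \<alpha>) - lsin_int 0)) {\<alpha>..pi / 2}"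
    using has_integral_lsin[of 0 "pi / 2 - \<alpha>"] \<alpha> b by (intro has_integral_shift) simp
  have j3: "((\<lambda>\<phi>. lsin (\<phi> + \<alpha>)) has_integral (lsin_int (pi / 2 + \<alpha>) - lsin_int (2 * \<alpha>))) {\<alpha>..pi / 2}"
    using has_integral_lsin[of "2 * \<alpha>" "pi / 2 + \<alpha>"] \<alpha> b by (intro has_integral_shift) simp
  have "((\<lambda>\<phi>. ?c * (2 * lsin \<phi> - lsin (\<phi> + - \<alpha>) - lsin (\<phi> + \<alpha>))) has_integral
      ?c * (2 * (lsin_int (pi / 2) - lsin_int \<alpha>) - (lsin_int (pi / 2 - \<alpha>) - lsin_int 0) - (lsin_int (pi / 2 + \<alpha>) - lsin_int (2 * \<alpha>)))) {\<alpha>..pi / 2}"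
    by (intro has_integral_mult_right has_integral_diff j1 j2 j3)
  moreover have "kern \<phi> \<alpha> = ?c * (2 * lsin \<phi> - lsin (\<phi> + - \<alpha>) - lsin (\<phi> + \<alpha>))" if "\<phi> \<in> {\<alpha>..pi / 2} - {\<alpha>}" for \<phi>
    using that by (simp add: kern_def)
  ultimately have r: "((\<lambda>\<phi>. kern \<phi> \<alpha>) has_integral
      ?c * (2 * (lsin_int (pi / 2) - lsin_int \<alpha>) - (lsin_int (pi / 2 - \<alpha>) - lsin_int 0) - (lsin_int (pi / 2 + \<alpha>) - lsin_int (2 * \<alpha>)))) {\<alpha>..pi / 2}"
    by (intro has_integral_spike_finite[where S = "{\<alpha>}" and g = "\<lambda>\<phi>. kern \<phi> \<alpha>"]) auto
  have "pi - (pi / 2 - \<alpha>) = pi / 2 + \<alpha>" by simp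
  then have "lsin_int (pi / 2 + \<alpha>) = - lsin_int (pi / 2 - \<alpha>)"
    using lsin_int_reflect[of "pi / 2 - \<alpha>"] \<alpha> b by simp
  then have e: "?c * ((lsin_int \<alpha> - lsin_int 0) + (lsin_int (2 * \<alpha>) - lsin_int \<alpha>)) +
      ?c * (2 * (lsin_int (pi / 2) - lsin_int \<alpha>) - (lsin_int (pi / 2 - \<alpha>) - lsin_int 0) - (lsin_int (pi / 2 + \<alpha>) - lsin_int (2 * \<alpha>)))
    = ?c * (2 * lsin_int (2 * \<alpha>) - 2 * lsin_int \<alpha>)"
    unfolding distrib_left[symmetric] by simp
  show ?thesis using has_integral_combine[OF _ _ l r] \<alpha> b unfolding e by simp
qed

section \<open>Integration by parts for the cotangent integral\<close>

lemma has_real_derivative_lsin_int: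
  assumes "0 < x" "x < pi"
  shows "(lsin_int has_real_derivative lsin x) (at x)"
proof -
  have "isCont lsin x"
    using has_real_derivative_lsin[OF sin_gt_zero[OF assms]] by (rule DERIV_isCont)
  then have "((\<lambda>u. integral {0..u} lsin) has_vector_derivative lsin x) (at x within {0..pi} - {})"
    using assms by (intro integral_has_vector_derivative_continuous_at lsin_integrable_on)
      (auto simp: continuous_at_imp_continuous_at_within)
  moreover have "at x within {0..pi} = at x" using assms by (intro at_within_interior) auto
  ultimately show ?thesis by (simp add: has_real_derivative_iff_has_vector_derivative lsin_int_def[abs_def])
qed

text \<open>Integrating \<open>ln t \<le> lsin t \<le> 1\<close>. The bound controls the boundary
  term at 0 in the integration by parts.\<close>

lemma lsin_int_bound:
  assumes "0 < x" "x \<le> pi / 2"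
  shows "\<bar>lsin_int x\<bar> \<le> 2 * x + \<bar>x * ln x\<bar>"
proof -
  have x: "lsin_int x \<le> x" "x * ln x - x \<le> lsin_int x"
  proof -
    have l: "(lsin has_integral lsin_int x) {0..x}"
      using has_integral_lsin[of 0 x] assms by simp
    have b: "ln t \<le> lsin t" "lsin t \<le> 1" if "t \<in> {0..x}" for t
    proof -
      have "ln t \<le> lsin t \<and> lsin t \<le> 1"
      \<comment> \<open>At 0 both inequalities hold by the convention
        \<open>ln 0 = 0\<close>.\<close>
      proof (cases "t = 0")
        case False
        then have tp: "0 < t" "t \<le> pi / 2" using that assms by auto
        have *: "t \<le> 2 * sin t" "2 * sin t \<le> 2" using sin_ge_half[of t] tp by auto
        then have "ln t \<le> lsin t" "lsin t \<le> ln 2" using tp unfolding lsin_def by (intro ln_mono; simp)+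
        moreover have "ln (2::real) \<le> 1" using ln_le_minus_one[of "2::real"] by simp
        ultimately show ?thesis by linarith
      qed (simp add: lsin_def)
      then show "ln t \<le> lsin t" "lsin t \<le> 1" by auto
    qed
    have "((\<lambda>t. 1) has_integral x) {0..x}"
      using assms by (intro has_integral_eq_rhs[OF has_integral_const_real]) simp
    from has_integral_le[OF l this b(2)] show "lsin_int x \<le> x" .
    have "continuous_on {0..x} (\<lambda>t. t * ln t - t)"
    proof (rule continuous_on_Icc_zeroI)
      show "((\<lambda>t. t * ln t - t) \<longlongrightarrow> 0 * ln 0 - 0) (at_right (0::real))" by simp real_asymp
    qed (auto intro!: continuous_intros)
    moreover have "((\<lambda>t. t * ln t - t) has_vector_derivative ln t) (at t)" if "t \<in> {0<..<x}" for t
      unfolding has_real_derivative_iff_has_vector_derivative[symmetric]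
      using that by (auto intro!: derivative_eq_intros)
    ultimately have "(ln has_integral (x * ln x - x) - (0 * ln 0 - 0)) {0..x}"
      using assms by (intro fundamental_theorem_of_calculus_interior) auto
    from has_integral_le[OF this l b(1)] show "x * ln x - x \<le> lsin_int x" by simp
  qed
  then show ?thesis using assms abs_ge_self[of "x * ln x"] abs_ge_minus_self[of "x * ln x"]
    by (intro abs_leI) linarith+
qed

text \<open>The cotangent is the derivative of \<open>lsin\<close>, so integration by parts leaves
  products of \<open>lsin\<close> values. The boundary term vanishes at 0 by
  \<open>lsin_int_bound\<close> and at \<open>pi / 6\<close> because
  \<open>lsin (pi / 6) = 0\<close>.\<close>

lemma has_integral_cot_lsin_int:
  "((\<lambda>\<alpha>. cos \<alpha> / sin \<alpha> * (2 * lsin_int (2 * \<alpha>) - 2 * lsin_int \<alpha>)) has_integral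
     2 * lsin_sq_int (pi / 2) - 3 * lsin_sq_int (pi / 3)) {0..pi / 6}"
proof -
  let ?U = "\<lambda>\<alpha>. lsin \<alpha> * (2 * lsin_int (2 * \<alpha>) - 2 * lsin_int \<alpha>)"
  let ?c = "\<lambda>\<alpha>. cos \<alpha> / sin \<alpha> * (2 * lsin_int (2 * \<alpha>) - 2 * lsin_int \<alpha>)"
  have D: "(?U has_real_derivative ?c \<alpha> + lsin \<alpha> * (4 * lsin (2 * \<alpha>) - 2 * lsin \<alpha>)) (at \<alpha>)"
    if "0 < \<alpha>" "\<alpha> \<le> pi / 6" for \<alpha>
  proof -
    have a: "\<alpha> < pi" "2 * \<alpha> < pi" using that pi_gt_zero by linarith+
    have "((\<lambda>\<alpha>. 2 * \<alpha>) has_real_derivative 2) (at \<alpha>)" by (auto intro!: derivative_eq_intros)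
    from DERIV_chain2[OF has_real_derivative_lsin_int[of "2 * \<alpha>"] this]
    have "((\<lambda>\<alpha>. lsin_int (2 * \<alpha>)) has_real_derivative lsin (2 * \<alpha>) * 2) (at \<alpha>)" using that a by simp
    from DERIV_diff[OF DERIV_cmult[OF this, of 2] DERIV_cmult[OF has_real_derivative_lsin_int[of \<alpha>], of 2]] that a
    have "((\<lambda>\<alpha>. 2 * lsin_int (2 * \<alpha>) - 2 * lsin_int \<alpha>) has_real_derivative 2 * (lsin (2 * \<alpha>) * 2) - 2 * lsin \<alpha>) (at \<alpha>)" by simp
    from DERIV_mult[OF has_real_derivative_lsin[OF sin_gt_zero] this] that a
    show ?thesis by (simp add: algebra_simps)
  qed
  have "continuous_on {0..pi / 6} ?U"
  proof (rule continuous_on_Icc_zeroI)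
    show "isCont ?U \<alpha>" if "0 < \<alpha>" "\<alpha> \<le> pi / 6" for \<alpha> using D[OF that] by (rule DERIV_isCont)
    \<comment> \<open>\<open>lsin_int_bound\<close> replaces both values of A by elementary terms,
      and the product is of order \<alpha> ln^2 \<alpha>.\<close>
    let ?B = "\<lambda>\<alpha>::real. \<bar>ln (2 * sin \<alpha>) * (2 * (2 * (2 * \<alpha>) + \<bar>2 * \<alpha> * ln (2 * \<alpha>)\<bar>) + 2 * (2 * \<alpha> + \<bar>\<alpha> * ln \<alpha>\<bar>))\<bar>"
    have "(?U \<longlongrightarrow> 0) (at_right 0)"
    proof (rule Lim_null_comparison)
      show "(?B \<longlongrightarrow> 0) (at_right 0)"
        by real_asymp
      have "\<forall>\<^sub>F \<alpha> in at_right 0. \<alpha> \<in> {0<..<pi / 6}" by (rule eventually_at_right_real) simp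
      then show "\<forall>\<^sub>F \<alpha> in at_right 0. norm (?U \<alpha>) \<le> ?B \<alpha>"
      proof eventually_elim
        case (elim \<alpha>)
        then have "0 < \<alpha>" "\<alpha> \<le> pi / 2" "2 * \<alpha> \<le> pi / 2" using pi_gt_zero by simp_all
        then have "\<bar>2 * lsin_int (2 * \<alpha>) - 2 * lsin_int \<alpha>\<bar> \<le>
            2 * (2 * (2 * \<alpha>) + \<bar>2 * \<alpha> * ln (2 * \<alpha>)\<bar>) + 2 * (2 * \<alpha> + \<bar>\<alpha> * ln \<alpha>\<bar>)"
          by (intro order_trans[OF _ add_mono[OF mult_left_mono[OF lsin_int_bound] mult_left_mono[OF lsin_int_bound]]]) auto
        then have "\<bar>2 * lsin_int (2 * \<alpha>) - 2 * lsin_int \<alpha>\<bar> \<le>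
            \<bar>2 * (2 * (2 * \<alpha>) + \<bar>2 * \<alpha> * ln (2 * \<alpha>)\<bar>) + 2 * (2 * \<alpha> + \<bar>\<alpha> * ln \<alpha>\<bar>)\<bar>"
          by (rule order_trans[OF _ abs_ge_self])
        then show ?case unfolding real_norm_def abs_mult[of "lsin \<alpha>"] abs_mult[of "ln (2 * sin \<alpha>)"]
          by (intro mult_mono) (auto simp: lsin_def)
      qed
    qed
    then show "(?U \<longlongrightarrow> ?U 0) (at_right 0)" by simp
  qed
  then have "((\<lambda>\<alpha>. ?c \<alpha> + lsin \<alpha> * (4 * lsin (2 * \<alpha>) - 2 * lsin \<alpha>)) has_integral (?U (pi / 6) - ?U 0)) {0..pi / 6}"
    using D by (intro fundamental_theorem_of_calculus_interior)
      (auto simp flip: has_real_derivative_iff_has_vector_derivative)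
  moreover have "?U (pi / 6) - ?U 0 = 0" by (simp add: lsin_def sin_30)
  ultimately have U: "((\<lambda>\<alpha>. ?c \<alpha> + lsin \<alpha> * (4 * lsin (2 * \<alpha>) - 2 * lsin \<alpha>)) has_integral 0) {0..pi / 6}" by (simp only:)
  have b2: "((\<lambda>t. (lsin (pi / 2 - t))\<^sup>2) has_integral lsin_sq_int (pi / 2) - lsin_sq_int (pi / 3)) {0..pi / 6}"
    using has_integral_reflect_at[OF has_integral_lsin_squared[of "pi / 3" "pi / 2"], of "pi / 2"] by simp
  have c2: "((\<lambda>t. (lsin (2 * t))\<^sup>2) has_integral (lsin_sq_int (2 * (pi / 6)) - lsin_sq_int (2 * 0)) / 2) {0..pi / 6}"
    by (intro has_integral_scale2[of "\<lambda>t. (lsin t)\<^sup>2"] has_integral_lsin_squared) auto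
  let ?I = "2 * ((lsin_sq_int (pi / 2) - lsin_sq_int (pi / 3)) - (lsin_sq_int (2 * (pi / 6)) - lsin_sq_int (2 * 0)) / 2)"
  have "((\<lambda>\<alpha>. ?c \<alpha> + lsin \<alpha> * (4 * lsin (2 * \<alpha>) - 2 * lsin \<alpha>) + 2 * ((lsin (pi / 2 - \<alpha>))\<^sup>2 - (lsin (2 * \<alpha>))\<^sup>2))
      has_integral (0 + ?I)) {0..pi / 6}"
    by (intro has_integral_add U has_integral_mult_right has_integral_diff b2 c2)
  then have "(?c has_integral (0 + ?I)) {0..pi / 6}"
  proof (rule has_integral_spike_finite[where S = "{0}", rotated 2])
    fix t assume "t \<in> {0..pi / 6} - {0}"
    then have t: "0 < t" "t < pi / 2" using pi_gt_zero by (auto simp only: Diff_iff atLeastAtMost_iff insert_iff)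
    \<comment> \<open>With \<open>a + b = lsin (2 * t)\<close>, the identity rewrites the mixed
      product left by the integration by parts through squares alone, so that only values of S
      remain.\<close>
    have "a * (4 * (a + b) - 2 * a) + 2 * (b\<^sup>2 - (a + b)\<^sup>2) = 0" for a b :: real
      by (simp add: power2_eq_square algebra_simps)
    from this[of "lsin t" "lsin (pi / 2 - t)"]
    show "?c t = ?c t + lsin t * (4 * lsin (2 * t) - 2 * lsin t) + 2 * ((lsin (pi / 2 - t))\<^sup>2 - (lsin (2 * t))\<^sup>2)"
      unfolding lsin_double[OF t] by linarith
  qed auto
  moreover have "0 + ?I = 2 * lsin_sq_int (pi / 2) - 3 * lsin_sq_int (pi / 3)" by simp
  ultimately show ?thesis by (simp only:)
qed

text \<open>The double integral of the kernel is evaluated in both orders, with majorant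
  \<open>pi\<^sup>2 / 6 + (lsin \<phi>)\<^sup>2\<close>; restoring the subtracted square contributes
  one more S(pi/2).\<close>

lemma has_integral_mean_log2_sin:
  "((\<lambda>\<phi>. mean_log2 (2 * sin \<phi>)) has_integral 3 * lsin_sq_int (pi / 2) - 3 * lsin_sq_int (pi / 3)) {0..pi / 2}"
proof -
  let ?P = "\<lambda>\<phi> N. (kern \<phi> has_integral mean_log2 (2 * sin \<phi>) - (lsin \<phi>)\<^sup>2) {0..pi / 6} \<and>
      ((\<lambda>\<alpha>. \<bar>kern \<phi> \<alpha>\<bar>) has_integral N) {0..pi / 6} \<and> N \<le> pi\<^sup>2 / 6 + (lsin \<phi>)\<^sup>2"
  have "\<forall>\<phi>\<in>{0..pi / 2} - {0, pi / 6}. \<exists>N. ?P \<phi> N"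
  proof
    fix \<phi> assume "\<phi> \<in> {0..pi / 2} - {0, pi / 6}"
    then have "0 < \<phi>" "\<phi> \<le> pi / 2" "\<phi> \<noteq> pi / 6" by auto
    then show "\<exists>N. ?P \<phi> N" by (rule has_integral_kern) (intro exI conjI)
  qed
  from bchoice[OF this] obtain N where N: "\<forall>\<phi>\<in>{0..pi / 2} - {0, pi / 6}. ?P \<phi> (N \<phi>)" ..
  have h: "(\<lambda>\<phi>. pi\<^sup>2 / 6 + (lsin \<phi>)\<^sup>2) integrable_on {0..pi / 2}"
    by (intro integrable_add integrable_const_ivl lsin_squared_integrable_on) auto
  have hm: "(\<lambda>\<phi>. pi\<^sup>2 / 6 + (lsin \<phi>)\<^sup>2) \<in> borel_measurable borel" by measurable
  let ?I = "integral\<^sup>L (lborel \<Otimes>\<^sub>M lborel) (case_prod (on_rect {0..pi / 2} {0..pi / 6} kern))"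
  have "((\<lambda>\<phi>. mean_log2 (2 * sin \<phi>) - (lsin \<phi>)\<^sup>2) has_integral ?I) {0..pi / 2}"
    using N by (intro Fubini_row_Icc[where S = "{0, pi / 6}" and N = N, OF kern_measurable _ _ _ _ hm h]) simp_all
  moreover have "((\<lambda>\<alpha>. cos \<alpha> / sin \<alpha> * (2 * lsin_int (2 * \<alpha>) - 2 * lsin_int \<alpha>)) has_integral ?I) {0..pi / 6}"
    using N by (intro Fubini_column_Icc[where S = "{0, pi / 6}" and T = "{0}" and N = N
        and F = "\<lambda>\<phi>. mean_log2 (2 * sin \<phi>) - (lsin \<phi>)\<^sup>2", OF kern_measurable _ _ _ _ hm h]
      has_integral_kern_column) simp_all
  then have "?I = 2 * lsin_sq_int (pi / 2) - 3 * lsin_sq_int (pi / 3)"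
    by (rule has_integral_unique[OF _ has_integral_cot_lsin_int])
  ultimately have "((\<lambda>\<phi>. mean_log2 (2 * sin \<phi>) - (lsin \<phi>)\<^sup>2) has_integral 2 * lsin_sq_int (pi / 2) - 3 * lsin_sq_int (pi / 3)) {0..pi / 2}"
    by (simp only:)
  from has_integral_add[OF this has_integral_lsin_squared[of 0 "pi / 2"]]
  show ?thesis by simp
qed

section \<open>The Mahler measure\<close>

lemma cmod_one_plus_cis: "cmod (1 + cis (2 * x)) = 2 * \<bar>cos x\<bar>"
proof -
  have "1 + cis (2 * x) = of_real (2 * cos x) * cis x"
    by (simp add: complex_eq_iff cos_double_cos sin_double power2_eq_square)
  then show ?thesis by (simp only: norm_mult norm_cis norm_of_real abs_mult abs_numeral mult_1_right)
qed

text \<open>The substitution \<open>\<phi> = pi / 2 - x\<close> and the symmetry about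
  \<open>pi / 2\<close> cover [0, pi] by two copies of the integral; the absolute cosine is half of
  \<open>\<bar>1 + cis (2 * pi * t)\<bar>\<close>.\<close>

lemma has_integral_mean_log2_cos:
  assumes "((\<lambda>\<phi>. mean_log2 (2 * sin \<phi>)) has_integral I) {0..pi / 2}"
  shows "((\<lambda>t. mean_log2 (2 * \<bar>cos (pi * t)\<bar>)) has_integral 2 * I / pi) {0..1}"
proof -
  have c: "((\<lambda>x. mean_log2 (2 * cos x)) has_integral I) {0..pi / 2}"
    using has_integral_reflect_at[OF assms, of "pi / 2"] by (simp add: sin_diff)
  have d: "((\<lambda>x. mean_log2 (2 * (- cos x))) has_integral I) {pi / 2..pi}"
    using has_integral_reflect_at[OF c, of pi] by simp
  have "((\<lambda>x. mean_log2 (2 * \<bar>cos x\<bar>)) has_integral I) {0..pi / 2}"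
    by (rule has_integral_eq[OF _ c]) (auto simp: cos_ge_zero)
  moreover have "\<bar>cos x\<bar> = - cos x" if "x \<in> {pi / 2..pi}" for x
  proof -
    have "0 \<le> cos (pi - x)" using that by (intro cos_ge_zero) auto
    then show ?thesis by simp
  qed
  then have "((\<lambda>x. mean_log2 (2 * \<bar>cos x\<bar>)) has_integral I) {pi / 2..pi}"
    by (intro has_integral_eq[OF _ d]) simp
  ultimately have "((\<lambda>x. mean_log2 (2 * \<bar>cos x\<bar>)) has_integral I + I) {0..pi}"
    by (intro has_integral_combine[where c = "pi / 2"]) auto
  from has_integral_affinity'[of _ _ 0 pi pi 0, simplified, OF this]
  show ?thesis by (simp add: field_simps)
qed

lemma higher_mahler2_eq:
  "higher_mahler2 2 (\<lambda>x y. 1 + x + y) = pi\<^sup>2 / 4 - 6 / pi * lsin_sq_int (pi / 3)"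
proof -
  define f where "f t s = (ln (cmod (1 + cis (2 * pi * t) + cis (2 * pi * s))))\<^sup>2" for t s
  have "(\<lambda>p. cmod (1 + cis (2 * pi * fst p) + cis (2 * pi * snd p))) \<in> borel_measurable borel"
    by (intro borel_measurable_continuous_onI continuous_intros)
  then have fm: "(\<lambda>p. f (fst p) (snd p)) \<in> borel_measurable borel"
    unfolding f_def by measurable
  then have meas: "case_prod f \<in> borel_measurable (borel \<Otimes>\<^sub>M borel)"
    unfolding borel_prod case_prod_unfold .
  let ?m = "\<lambda>t. mean_log2 (2 * \<bar>cos (pi * t)\<bar>)"
  \<comment> \<open>These points are 1/3 and 2/3, where \<open>\<bar>1 + x\<bar> = 1\<close> and the
    formula for the circle mean has not been established.\<close>
  let ?S = "{arccos (1 / 2) / pi, arccos (- (1 / 2)) / pi}"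
  have row: "(f t has_integral ?m t) {0..1}" if t: "t \<in> {0..1} - ?S" for t
  proof -
    have "arccos (cos (pi * t)) = pi * t" using t by (intro arccos_cos) auto
    then have "t = arccos c / pi" if "cos (pi * t) = c" for c
      using that by simp
    then have "cos (pi * t) \<noteq> 1 / 2" "cos (pi * t) \<noteq> - (1 / 2)" using t by blast+
    then have "2 * \<bar>cos (pi * t)\<bar> \<noteq> 1" by linarith
    moreover have "cmod (1 + cis (2 * pi * t)) = 2 * \<bar>cos (pi * t)\<bar>"
      using cmod_one_plus_cis[of "pi * t"] by (simp add: mult.assoc)
    ultimately show ?thesis
      using has_integral_mean_log2[of "1 + cis (2 * pi * t)"] by (simp only: f_def[abs_def]) simp
  qed
  \<comment> \<open>The integrand is a square, so the row integrals serve as their own absolute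
    bounds.\<close>
  have row': "((\<lambda>s. \<bar>f t s\<bar>) has_integral ?m t) {0..1}" if t: "t \<in> {0..1} - ?S" for t
  proof -
    have "\<bar>f t s\<bar> = f t s" for s by (simp add: f_def)
    then show ?thesis using row[OF t] by (simp only:)
  qed
  have m: "(?m has_integral 2 * (3 * lsin_sq_int (pi / 2) - 3 * lsin_sq_int (pi / 3)) / pi) {0..1}"
    by (rule has_integral_mean_log2_cos[OF has_integral_mean_log2_sin])
  have mm: "?m \<in> borel_measurable borel"
    by (rule measurable_compose[OF _ mean_log2_borel]) measurable
  have "(?m has_integral integral\<^sup>L (lborel \<Otimes>\<^sub>M lborel) (case_prod (on_rect {0..1} {0..1} f))) {0..1}"
    by (rule Fubini_row_Icc[where S = ?S, OF meas _ row row' order_refl mm has_integral_integrable[OF m]])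
      (auto intro: mean_log2_nonneg)
  then have int: "integral\<^sup>L (lborel \<Otimes>\<^sub>M lborel) (case_prod (on_rect {0..1} {0..1} f))
      = 2 * (3 * lsin_sq_int (pi / 2) - 3 * lsin_sq_int (pi / 3)) / pi"
    by (rule has_integral_unique[OF _ m])
  have R: "{0..1} \<times> {0..1} \<in> sets (borel :: (real \<times> real) measure)"
    by (intro borel_closed closed_Times) auto
  have "higher_mahler2 2 (\<lambda>x y. 1 + x + y) = (LINT p|lebesgue_on ({0..1} \<times> {0..1}). f (fst p) (snd p))"
    by (simp add: higher_mahler2_def f_def)
  \<comment> \<open>The integral over the square is rewritten with an indicator and moved from the
    completed measure to \<open>lborel\<close>, where the product form applies.\<close>
  also have "\<dots> = (LINT p|lebesgue. indicator ({0..1} \<times> {0..1}) p *\<^sub>R f (fst p) (snd p))"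
  proof (rule integral_restrict_space)
    show "{0..1} \<times> {0..1} \<inter> space lebesgue \<in> sets (lebesgue :: (real \<times> real) measure)"
      using sets_completionI_sets[of _ lborel] R by (simp only: space_completion space_lborel space_borel Int_UNIV_right sets_lborel)
  qed
  also have "\<dots> = (LINT p|lborel. indicator ({0..1} \<times> {0..1}) p *\<^sub>R f (fst p) (snd p))"
  proof (rule integral_completion)
    have "(\<lambda>p. indicator ({0..1} \<times> {0..1}) p *\<^sub>R f (fst p) (snd p)) \<in> borel_measurable borel"
      by (rule borel_measurable_scaleR[OF borel_measurable_indicator[OF R] fm])
    then show "(\<lambda>p. indicator ({0..1} \<times> {0..1}) p *\<^sub>R f (fst p) (snd p)) \<in> borel_measurable lborel"
      by (simp only: measurable_lborel2)
  qed
  also have "(\<lambda>p. indicator ({0..1} \<times> {0..1}) p *\<^sub>R f (fst p) (snd p)) = case_prod (on_rect {0..1} {0..1} f)"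
    by (auto simp: on_rect_def fun_eq_iff indicator_def)
  finally show ?thesis
    unfolding lborel_prod[symmetric] int lsin_sq_int_pi_half by (simp add: field_simps power2_eq_square power3_eq_cube)
qed

text \<open>Substituting \<open>t / 2\<close> doubles the integral, and the sine is nonnegative on
  the range. Since the integrand is a square, gauge integrability already gives the Lebesgue
  integral in \<open>Ls3\<close>.\<close>

lemma Ls3_eq: "Ls3 (2 * pi / 3) = - 2 * lsin_sq_int (pi / 3)"
proof -
  have eq: "(ln \<bar>2 * sin (t / 2)\<bar>)\<^sup>2 = (lsin (t / 2))\<^sup>2" if "t \<in> {0..2 * pi / 3}" for t
  proof -
    have "0 \<le> sin (t / 2)" using that by (intro sin_ge_zero) auto
    then show ?thesis by (simp add: lsin_def)
  qed
  have "((\<lambda>t. (lsin (t / 2))\<^sup>2) has_integral 2 * (lsin_sq_int (2 * pi / 3 / 2) - lsin_sq_int (0 / 2))) {0..2 * pi / 3}"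
    by (intro has_integral_half[of "\<lambda>t. (lsin t)\<^sup>2"] has_integral_lsin_squared) auto
  moreover have "2 * (lsin_sq_int (2 * pi / 3 / 2) - lsin_sq_int (0 / 2)) = 2 * lsin_sq_int (pi / 3)" by simp
  ultimately have "((\<lambda>t. (lsin (t / 2))\<^sup>2) has_integral 2 * lsin_sq_int (pi / 3)) {0..2 * pi / 3}" by (simp only:)
  then have h: "((\<lambda>t. (ln \<bar>2 * sin (t / 2)\<bar>)\<^sup>2) has_integral 2 * lsin_sq_int (pi / 3)) {0..2 * pi / 3}"
    by (rule has_integral_eq[rotated]) (rule eq[symmetric])
  have "has_bochner_integral lborel (\<lambda>t. indicator {0..2 * pi / 3} t * (ln \<bar>2 * sin (t / 2)\<bar>)\<^sup>2) (2 * lsin_sq_int (pi / 3))"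
    using h by (intro has_bochner_integral_Icc) auto
  then have "set_integrable lborel {0..2 * pi / 3} (\<lambda>t. (ln \<bar>2 * sin (t / 2)\<bar>)\<^sup>2)"
    by (simp add: set_integrable_def has_bochner_integral_iff)
  then have "(LBINT t=0..2 * pi / 3. (ln \<bar>2 * sin (t / 2)\<bar>)\<^sup>2) = 2 * lsin_sq_int (pi / 3)"
    using interval_integral_eq_integral[of 0 "2 * pi / 3" "\<lambda>t. (ln \<bar>2 * sin (t / 2)\<bar>)\<^sup>2"] integral_unique[OF h]
    by (simp add: zero_ereal_def)
  then show ?thesis by (simp add: Ls3_def)
qed

theorem theorem4p4:
  shows "higher_mahler2 2 (\<lambda>x y. 1 + x + y) =
           24 / (5 * pi) * Ti3 (1 / sqrt 3) + 2 * ln 3 / pi * Cl2 (pi / 3)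
           - (ln 3) ^ 2 / 10 - 19 * pi ^ 2 / 180
       \<and> higher_mahler2 2 (\<lambda>x y. 1 + x + y) = pi ^ 2 / 4 + 3 / pi * Ls3 (2 * pi / 3)"
  unfolding higher_mahler2_eq Ti3_Cl2_eq Ls3_eq by simp

end
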